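(* Let $\mathscr B$ be the event-wise Wasserstein ambiguity set: the set of probability distributions $\mathbb Q$ of $(\tilde{\boldsymbol\xi},\tilde l)$ on $\mathbb R^{\mathcal Tn_\xi}\times[L]$ such that for all $l\in[L]$: $\mathbb Q(\tilde l=l)=p_l$, $\mathbb Q(\tilde{\boldsymbol\xi}\in\varXi^l\mid\tilde l=l)=1$, and $d_W\big(\mathbb Q(\tilde{\boldsymbol\xi}\mid\tilde l=l),\widehat{\mathbb P}^l\big)\le\theta_l$, where $\widehat{\mathbb P}^l=\frac1{N_l}\sum_{s=1}^{N_l}\delta_{\widehat{\boldsymbol\xi}^{l,s}}$ and $\sum_{l=1}^Lp_l=1$. Then the objective function $$\min_{\boldsymbol Y_t^l,\boldsymbol y_t^{l,0},\boldsymbol Z_t^l,\boldsymbol z_t^{l,0}}\ \max_{\mathbb P\in\mathscr B}\mathbb E_{(\tilde{\boldsymbol\xi},\tilde l)\sim\mathbb P}\Big[\sum_{l=1}^L\mathbf 1_{\tilde l=l}\max_{k\in[K]}\{(\boldsymbol d_k^l)^TG^l(\tilde{\boldsymbol\xi})+r_k^l\}\Big]$$ admits the following equivalent reformulation: $$\begin{aligned}\min_{\lambda_l,\eta^{l,s},\eta^{l,s}_{k,t,i},\zeta^{l,s}_{k,t,i,j},\boldsymbol Y_t^l,\boldsymbol y_t^{l,0},\boldsymbol Z_t^l,\boldsymbol z_t^{l,0}}\quad&\sum_{l=1}^Lp_l\Big[\lambda_l\theta_l+\frac1{N_l}\sum_{s=1}^{N_l}\eta^{l,s}\Big]\\ \text{s.t.}\quad&\eta^{l,s}\ge\sum_{t=1}^{\mathcal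 T}\sum_{i=1}^{n_\xi}\eta^{l,s}_{k,t,i}+r_k^l,\\ &\eta^{l,s}_{k,t,i}\ge(\boldsymbol d^l_{k,t,i})^T\boldsymbol\varphi^{l-}_{t,i,j}-\zeta^{l,s}_{k,t,i,j}\big(\boldsymbol R_{t,i}^l\boldsymbol\varphi^{l-}_{t,i,j}-\widehat\xi^{l,s}_{t,i}\big),\\ &\eta^{l,s}_{k,t,i}\ge(\boldsymbol d^l_{k,t,i})^T\boldsymbol\varphi^l_{t,i,j-1}-\zeta^{l,s}_{k,t,i,j}\big(\boldsymbol R_{t,i}^l\boldsymbol\varphi^l_{t,i,j-1}-\widehat\xi^{l,s}_{t,i}\big),\\ &|\zeta^{l,s}_{k,t,i,j}|\le\lambda_l,\\ &\forall l\in[L],s\in[N_l],k\in[K],t\in[\mathcal T],i\in[n_\xi],j\in[p^l_{t,i}].\end{aligned}$$ That is, for every fixed value of the policy coefficients $(\boldsymbol Y_t^l,\boldsymbol y_t^{l,0},\boldsymbol Z_t^l,\boldsymbol z_t^{l,0})_{t,l}$, the worst-case expectation equals the optimal value of the displayed minimization over the remaining real variables.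
   Context: **Disturbance.** $[N]=\{1,\dots,N\}$; $L$ is the number of scenarios of an event and $p_l$ the probability of scenario $l$. For each $l\in[L]$ the disturbance conditional on scenario $l$ has as support a hyperrectangle $\varXi^l=\prod_{t\in[\mathcal T],i\in[n_\xi]}[l^l_{t,i},v^l_{t,i}]$, and data $\widehat{\boldsymbol\xi}^{l,s}\in\varXi^l$, $s\in[N_l]$, with components $\widehat\xi^{l,s}_{t,i}$; $\theta_l$ is the Wasserstein radius for scenario $l$ and $\delta_{(\cdot)}$ the Dirac distribution. $\|\cdot\|$ is the 1-norm and $d_W(\mathbb Q,\widehat{\mathbb P})=\inf_\kappa\int\|\boldsymbol\xi_1-\boldsymbol\xi_2\|\,d\kappa(\boldsymbol\xi_1,\boldsymbol\xi_2)$ over couplings $\kappa$ (Borel probability measures on $\varXi^l\times\varXi^l$ with marginals $\mathbb Q$ and $\widehat{\mathbb P}$) of the two Borel probability measures on $\varXi^l$. $\mathbf 1$ is the indicator function. **Lifting.** For each $l$ and $(t,i)$ there are an integer $p^l_{t,i}\ge1$ and breakpoints $l^l_{t,i}=w^l_{t,i,0}\le w^l_{t,i,1}\le\dots\le w^l_{t,i,p^l_{t,i}}=v^l_{t,i}$. Let $G^l_{t,i}(\xi_{t,i})=(V_1,\dots,V_{p},Q_1,\dots,Q_{p-1})^T$ ($p=p^l_{t,i}$, $w_j=w^l_{t,i,j}$) with $V_1=\min\{\xi_{t,i},w_1\}$, $V_j=\max\{\min\{\xi_{t,i},w_j\}-w_{j-1},0\}$ for $2\le j\le p$, and, for $j\in[p-1]$,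 $Q_j=0$ if $\xi_{t,i}<w_j$, $Q_j=1$ if $\xi_{t,i}\ge w_j$. $G^l(\boldsymbol\xi)$ stacks all $G^l_{t,i}(\xi_{t,i})$ in the order $(1,1),\dots,(1,n_\xi),(2,1),\dots,(\mathcal T,n_\xi)$. $\boldsymbol R^l_{t,i}$ is the row vector with ones on the $V$-coordinates and zeros on the $Q$-coordinates, so $\boldsymbol R^l_{t,i}G^l_{t,i}(\xi_{t,i})=\xi_{t,i}$. $\boldsymbol\varphi^l_{t,i,j}=G^l_{t,i}(w^l_{t,i,j})$ and $\boldsymbol\varphi^{l-}_{t,i,j}=\lim_{\xi\nearrow w^l_{t,i,j}}G^l_{t,i}(\xi)$ is the left limit. **Objective.** For each scenario $l$ the policy coefficients are $\boldsymbol Y^l_t\in\mathbb R^{n_u\times n_{V_t^l}}$, $\boldsymbol y_t^{l,0}\in\mathbb R^{n_u}$, $\boldsymbol Z_t^l\in\mathbb Z^{n_\gamma\times n_{Q_t^l}}$, $\boldsymbol z_t^{l,0}\in\mathbb Z^{n_\gamma}$, $t\in[\mathcal T]$, where $n_{V_t^l}=\sum_{t'\le t}\sum_ip^l_{t',i}$, $n_{Q_t^l}=\sum_{t'\le t}\sum_i(p^l_{t',i}-1)$. They parametrize the lifted policy used in scenario $l$: $\boldsymbol u_t=\boldsymbol Y^l_t\boldsymbol V^l_{[t]}+\boldsymbol y_t^{l,0}$ and $\boldsymbol\gamma_t=\boldsymbol Z^l_t\boldsymbol Q^l_{[t]}+\boldsymbol z_t^{l,0}$, where $\boldsymbol V^l_{[t]},\boldsymbol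 Q^l_{[t]}$ stack the $V$'s and $Q$'s of scenario $l$ up to time $t$. The vectors $\boldsymbol d^l_k$ and scalars $r^l_k$, $k\in[K]$, are affine functions of the scenario-$l$ coefficients, obtained by writing the total cost $\sum_{t=1}^{\mathcal T}\alpha^tc_t(\boldsymbol x_t,\boldsymbol u_t,\boldsymbol\gamma_t)$ with discount factors $\alpha^t\in[0,1]$ and convex piecewise linear costs $c_t=\max_{\tau\in[I]}\{\boldsymbol a_\tau^T\boldsymbol x_t+\boldsymbol b_\tau^T\boldsymbol u_t+\boldsymbol c_\tau^T\boldsymbol\gamma_t\}$ of the linear system $\boldsymbol x_{t+1}=\boldsymbol A_t\boldsymbol x_t+\boldsymbol B_t\boldsymbol u_t+\boldsymbol C_t\boldsymbol\gamma_t+\boldsymbol D_t\boldsymbol\xi_t$ under the scenario-$l$ lifted policy as $\max_{k\in[K]}\{(\boldsymbol d^l_k)^TG^l(\boldsymbol\xi)+r^l_k\}$; $\boldsymbol d^l_{k,t,i}$ is the $(t,i)$ block of $\boldsymbol d^l_k$ in the partition matching $G^l$.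
   Formalization: The radii θ_l are assumed positive (at θ_l=0 the claim fails for a sample at a breakpoint where G jumps), and where w_j equals the left end w_0 of the support, φ^-_j is taken as G(w_j) instead of the left limit along the real line, with which the claim fails. *)

theory Defs
  imports "HOL-Probability.Probability"
begin

text \<open>
  A disturbance trajectory is a function \<open>\<xi>\<close> on the periods \<open>{1..T}\<close> (extensional outside of
  them) with values in \<open>real ^ 'n\<close>, so that \<open>\<xi> t $ i\<close> is the component \<open>(t, i)\<close> and the space of
  trajectories is the product of \<open>T\<close> copies of \<open>real ^ 'n\<close>. Scenarios, samples, periods, pieces
  and breakpoints are numbered by natural numbers as on paper, i.e. from 1, except for the
  breakpoints, which start at 0.
\<close>

type_synonym 'n trajectory = "nat \<Rightarrow> real ^ 'n"

definition traj_space :: "nat \<Rightarrow> ('n::finite) trajectory measure" where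
  "traj_space T = PiM {1..T} (\<lambda>_. borel)"

definition support_box ::
    "nat \<Rightarrow> (nat \<Rightarrow> 'n \<Rightarrow> real) \<Rightarrow> (nat \<Rightarrow> 'n \<Rightarrow> real) \<Rightarrow> ('n::finite) trajectory set" where
  "support_box T lo hi =
     {\<xi> \<in> space (traj_space T). \<forall>t\<in>{1..T}. \<forall>i. lo t i \<le> \<xi> t $ i \<and> \<xi> t $ i \<le> hi t i}"

definition norm1_dist :: "nat \<Rightarrow> ('n::finite) trajectory \<Rightarrow> 'n trajectory \<Rightarrow> real" where
  "norm1_dist T \<xi> \<xi>' = (\<Sum>t=1..T. \<Sum>i\<in>UNIV. \<bar>\<xi> t $ i - \<xi>' t $ i\<bar>)"


section \<open>Lifting\<close>

text \<open>
  For one component with \<open>p\<close> pieces and breakpoints \<open>w 0, \<dots>, w p\<close>, the lifted vector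
  \<open>(V_1, \<dots>, V_p, Q_1, \<dots>, Q_{p-1})\<close> is a function on the positions \<open>{1..2 * p - 1}\<close>; only these
  positions are ever used.
\<close>

definition V_part :: "(nat \<Rightarrow> real) \<Rightarrow> real \<Rightarrow> nat \<Rightarrow> real" where
  "V_part w x j = (if j = 1 then min x (w 1) else max (min x (w j) - w (j - 1)) 0)"

definition Q_part :: "(nat \<Rightarrow> real) \<Rightarrow> real \<Rightarrow> nat \<Rightarrow> real" where
  "Q_part w x j = (if x < w j then 0 else 1)"

definition lift_comp :: "nat \<Rightarrow> (nat \<Rightarrow> real) \<Rightarrow> real \<Rightarrow> nat \<Rightarrow> real" where
  "lift_comp p w x m = (if m \<le> p then V_part w x m else Q_part w x (m - p))"

definition R_row :: "nat \<Rightarrow> nat \<Rightarrow> real" where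
  "R_row p m = (if m \<le> p then 1 else 0)"

definition lift_dot :: "nat \<Rightarrow> (nat \<Rightarrow> real) \<Rightarrow> (nat \<Rightarrow> real) \<Rightarrow> real" where
  "lift_dot p a b = (\<Sum>m=1..2 * p - 1. a m * b m)"

definition phi :: "nat \<Rightarrow> (nat \<Rightarrow> real) \<Rightarrow> nat \<Rightarrow> nat \<Rightarrow> real" where
  "phi p w j = lift_comp p w (w j)"

text \<open>
  The left limit is taken along the support interval \<open>{w 0..w p}\<close>. If \<open>w j = w 0\<close> is the left
  end point of this interval (coinciding breakpoints are allowed), there is nothing to the left of
  \<open>w j\<close> in the support, and the value at the point is used. The limit along the whole real line
  would in this case bring in a lifted vector with \<open>Q_j = 0\<close>, which is not a limit of lifted
  vectors of points of the support.
\<close>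

definition phi_minus :: "nat \<Rightarrow> (nat \<Rightarrow> real) \<Rightarrow> nat \<Rightarrow> nat \<Rightarrow> real" where
  "phi_minus p w j m =
     (if w 0 < w j then Lim (at_left (w j)) (\<lambda>x. lift_comp p w x m) else lift_comp p w (w j) m)"

text \<open>The inner product of a vector in block form with the full lifted trajectory.\<close>

definition full_dot ::
    "nat \<Rightarrow> (nat \<Rightarrow> 'n \<Rightarrow> nat) \<Rightarrow> (nat \<Rightarrow> 'n \<Rightarrow> nat \<Rightarrow> real) \<Rightarrow>
     (nat \<Rightarrow> 'n \<Rightarrow> nat \<Rightarrow> real) \<Rightarrow> ('n::finite) trajectory \<Rightarrow> real" where
  "full_dot T p w d \<xi> =
     (\<Sum>t=1..T. \<Sum>i\<in>UNIV. lift_dot (p t i) (d t i) (lift_comp (p t i) (w t i) (\<xi> t $ i)))"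


section \<open>Lifted policies and their cost\<close>

text \<open>
  The columns of the matrices \<open>Y\<^sub>t\<close> and \<open>Z\<^sub>t\<close> are indexed by the coordinates \<open>(t', i, j)\<close> of the
  stacked vectors of the \<open>V\<close>'s and the \<open>Q\<close>'s up to time \<open>t\<close>, that is, by the two sets below.
\<close>

definition V_index :: "(nat \<Rightarrow> 'n \<Rightarrow> nat) \<Rightarrow> nat \<Rightarrow> (nat \<times> 'n \<times> nat) set" where
  "V_index p t = {(t', i, j). t' \<in> {1..t} \<and> j \<in> {1..p t' i}}"

definition Q_index :: "(nat \<Rightarrow> 'n \<Rightarrow> nat) \<Rightarrow> nat \<Rightarrow> (nat \<times> 'n \<times> nat) set" where
  "Q_index p t = {(t', i, j). t' \<in> {1..t} \<and> j \<in> {1..p t' i - 1}}"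

record ('n, 'u, 'g) coeffs =
  coefY :: "nat \<Rightarrow> nat \<times> 'n \<times> nat \<Rightarrow> real ^ 'u"
  coefy0 :: "nat \<Rightarrow> real ^ 'u"
  coefZ :: "nat \<Rightarrow> nat \<times> 'n \<times> nat \<Rightarrow> int ^ 'g"
  coefz0 :: "nat \<Rightarrow> int ^ 'g"

definition policy_u ::
    "(nat \<Rightarrow> 'n \<Rightarrow> nat) \<Rightarrow> (nat \<Rightarrow> 'n \<Rightarrow> nat \<Rightarrow> real) \<Rightarrow> ('n::finite, 'u::finite, 'g::finite) coeffs \<Rightarrow>
     'n trajectory \<Rightarrow> nat \<Rightarrow> real ^ 'u" where
  "policy_u p w c \<xi> t =
     (\<chi> a. (\<Sum>(t', i, j)\<in>V_index p t. coefY c t (t', i, j) $ a * V_part (w t' i) (\<xi> t' $ i) j)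
           + coefy0 c t $ a)"

definition policy_gamma ::
    "(nat \<Rightarrow> 'n \<Rightarrow> nat) \<Rightarrow> (nat \<Rightarrow> 'n \<Rightarrow> nat \<Rightarrow> real) \<Rightarrow> ('n::finite, 'u::finite, 'g::finite) coeffs \<Rightarrow>
     'n trajectory \<Rightarrow> nat \<Rightarrow> real ^ 'g" where
  "policy_gamma p w c \<xi> t =
     (\<chi> b. (\<Sum>(t', i, j)\<in>Q_index p t.
              real_of_int (coefZ c t (t', i, j) $ b) * Q_part (w t' i) (\<xi> t' $ i) j)
           + real_of_int (coefz0 c t $ b))"

definition affine_in_coeffs ::
    "nat \<Rightarrow> (nat \<Rightarrow> 'n \<Rightarrow> nat) \<Rightarrow> (('n::finite, 'u::finite, 'g::finite) coeffs \<Rightarrow> real) \<Rightarrow> bool" where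
  "affine_in_coeffs T p F \<longleftrightarrow>
     (\<exists>c0 cY cy cZ cz. \<forall>c. F c = c0
        + (\<Sum>t=1..T. \<Sum>a\<in>UNIV. (\<Sum>q\<in>V_index p t. cY t q a * coefY c t q $ a)
                                + cy t a * coefy0 c t $ a)
        + (\<Sum>t=1..T. \<Sum>b\<in>UNIV. (\<Sum>q\<in>Q_index p t. cZ t q b * real_of_int (coefZ c t q $ b))
                                + cz t b * real_of_int (coefz0 c t $ b)))"

definition system_trajectory ::
    "nat \<Rightarrow> real ^ 'x \<Rightarrow> (nat \<Rightarrow> real ^ 'x ^ 'x) \<Rightarrow> (nat \<Rightarrow> real ^ 'u ^ 'x) \<Rightarrow> (nat \<Rightarrow> real ^ 'g ^ 'x) \<Rightarrow>
     (nat \<Rightarrow> real ^ 'n ^ 'x) \<Rightarrow> (nat \<Rightarrow> real ^ 'x) \<Rightarrow> (nat \<Rightarrow> real ^ 'u) \<Rightarrow> (nat \<Rightarrow> real ^ 'g) \<Rightarrow>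
     ('n::finite) trajectory \<Rightarrow> bool" where
  "system_trajectory T x1 A B C D x u \<gamma> \<xi> \<longleftrightarrow>
     x 1 = x1 \<and> (\<forall>t\<in>{1..<T}. x (t + 1) = A t *v x t + B t *v u t + C t *v \<gamma> t + D t *v \<xi> t)"

definition total_cost ::
    "nat \<Rightarrow> (nat \<Rightarrow> real) \<Rightarrow> nat \<Rightarrow> (nat \<Rightarrow> real ^ 'x) \<Rightarrow> (nat \<Rightarrow> real ^ 'u) \<Rightarrow> (nat \<Rightarrow> real ^ 'g) \<Rightarrow>
     (nat \<Rightarrow> real ^ 'x::finite) \<Rightarrow> (nat \<Rightarrow> real ^ 'u::finite) \<Rightarrow> (nat \<Rightarrow> real ^ 'g::finite) \<Rightarrow> real" where
  "total_cost T \<alpha> nI a b c x u \<gamma> =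
     (\<Sum>t=1..T. \<alpha> t * (MAX \<tau>\<in>{1..nI}. a \<tau> \<bullet> x t + b \<tau> \<bullet> u t + c \<tau> \<bullet> \<gamma> t))"


section \<open>The event-wise Wasserstein ambiguity set\<close>

definition couplings :: "'a measure \<Rightarrow> 'a measure \<Rightarrow> 'a measure \<Rightarrow> ('a \<times> 'a) measure set" where
  "couplings S P P' =
     {\<kappa>. prob_space \<kappa> \<and> sets \<kappa> = sets (S \<Otimes>\<^sub>M S) \<and> distr \<kappa> S fst = P \<and> distr \<kappa> S snd = P'}"

definition wasserstein ::
    "nat \<Rightarrow> ('n::finite) trajectory measure \<Rightarrow> 'n trajectory measure \<Rightarrow> 'n trajectory measure \<Rightarrow> ennreal" where
  "wasserstein T S P P' =
     (INF \<kappa>\<in>couplings S P P'. \<integral>\<^sup>+ z. ennreal (norm1_dist T (fst z) (snd z)) \<partial>\<kappa>)"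

definition empirical :: "'a measure \<Rightarrow> nat \<Rightarrow> (nat \<Rightarrow> 'a) \<Rightarrow> 'a measure" where
  "empirical S N xs =
     measure_of (space S) (sets S)
       (\<lambda>E. ennreal (1 / real N) * (\<Sum>s=1..N. emeasure (return S (xs s)) E))"

definition cond_law :: "nat \<Rightarrow> (('n::finite) trajectory \<times> nat) measure \<Rightarrow> nat \<Rightarrow> 'n trajectory measure" where
  "cond_law T Q l = distr (uniform_measure Q {\<omega> \<in> space Q. snd \<omega> = l}) (traj_space T) fst"

text \<open>
  The conditions on the conditional distribution given scenario \<open>l\<close> are void if that scenario
  has probability 0. The Wasserstein distance is between Borel probability measures on the support.
\<close>

definition ambiguity_set ::
    "nat \<Rightarrow> nat \<Rightarrow> (nat \<Rightarrow> real) \<Rightarrow> (nat \<Rightarrow> ('n::finite) trajectory set) \<Rightarrow> (nat \<Rightarrow> nat) \<Rightarrow>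
     (nat \<Rightarrow> nat \<Rightarrow> 'n trajectory) \<Rightarrow> (nat \<Rightarrow> real) \<Rightarrow> ('n trajectory \<times> nat) measure set" where
  "ambiguity_set T L prb Xi N xhat \<theta> =
     {Q. prob_space Q \<and> sets Q = sets (traj_space T \<Otimes>\<^sub>M count_space {1..L}) \<and>
         (\<forall>l\<in>{1..L}.
            \<P>(\<omega> in Q. snd \<omega> = l) = prb l \<and>
            (prb l > 0 \<longrightarrow>
               \<P>(\<omega> in Q. fst \<omega> \<in> Xi l \<bar> snd \<omega> = l) = 1 \<and>
               wasserstein T (restrict_space (traj_space T) (Xi l))
                 (restrict_space (cond_law T Q l) (Xi l))
                 (empirical (restrict_space (traj_space T) (Xi l)) (N l) (xhat l))
               \<le> ennreal (\<theta> l)))}"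

text \<open>
  In the following, \<open>d l k t i\<close> and \<open>r l k\<close> are the values of the cost coefficients for fixed
  policy coefficients.
\<close>

definition expected_cost ::
    "nat \<Rightarrow> nat \<Rightarrow> nat \<Rightarrow> (nat \<Rightarrow> nat \<Rightarrow> 'n \<Rightarrow> nat) \<Rightarrow> (nat \<Rightarrow> nat \<Rightarrow> 'n \<Rightarrow> nat \<Rightarrow> real) \<Rightarrow>
     (nat \<Rightarrow> nat \<Rightarrow> nat \<Rightarrow> 'n \<Rightarrow> nat \<Rightarrow> real) \<Rightarrow> (nat \<Rightarrow> nat \<Rightarrow> real) \<Rightarrow>
     (('n::finite) trajectory \<times> nat) measure \<Rightarrow> real" where
  "expected_cost T L K p w d r Q =
     (\<integral>\<omega>. (\<Sum>l=1..L. indicator {l} (snd \<omega>) *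
              (MAX k\<in>{1..K}. full_dot T (p l) (w l) (d l k) (fst \<omega>) + r l k)) \<partial>Q)"


section \<open>The reformulation\<close>

record 'n aux_vars =
  lam :: "nat \<Rightarrow> real"
  eta :: "nat \<Rightarrow> nat \<Rightarrow> real"
  eta_comp :: "nat \<Rightarrow> nat \<Rightarrow> nat \<Rightarrow> nat \<Rightarrow> 'n \<Rightarrow> real"
  zeta :: "nat \<Rightarrow> nat \<Rightarrow> nat \<Rightarrow> nat \<Rightarrow> 'n \<Rightarrow> nat \<Rightarrow> real"

definition aux_feasible ::
    "nat \<Rightarrow> nat \<Rightarrow> nat \<Rightarrow> (nat \<Rightarrow> nat) \<Rightarrow> (nat \<Rightarrow> nat \<Rightarrow> ('n::finite) trajectory) \<Rightarrow>
     (nat \<Rightarrow> nat \<Rightarrow> 'n \<Rightarrow> nat) \<Rightarrow> (nat \<Rightarrow> nat \<Rightarrow> 'n \<Rightarrow> nat \<Rightarrow> real) \<Rightarrow>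
     (nat \<Rightarrow> nat \<Rightarrow> nat \<Rightarrow> 'n \<Rightarrow> nat \<Rightarrow> real) \<Rightarrow> (nat \<Rightarrow> nat \<Rightarrow> real) \<Rightarrow> 'n aux_vars \<Rightarrow> bool" where
  "aux_feasible T L K N xhat p w d r v \<longleftrightarrow>
     (\<forall>l\<in>{1..L}. \<forall>s\<in>{1..N l}. \<forall>k\<in>{1..K}.
        eta v l s \<ge> (\<Sum>t=1..T. \<Sum>i\<in>UNIV. eta_comp v l s k t i) + r l k \<and>
        (\<forall>t\<in>{1..T}. \<forall>i. \<forall>j\<in>{1..p l t i}.
           (let pc = p l t i; wc = w l t i; dc = d l k t i in
              eta_comp v l s k t i \<ge>
                lift_dot pc dc (phi_minus pc wc j)
                - zeta v l s k t i j * (lift_dot pc (R_row pc) (phi_minus pc wc j) - xhat l s t $ i) \<and>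
              eta_comp v l s k t i \<ge>
                lift_dot pc dc (phi pc wc (j - 1))
                - zeta v l s k t i j * (lift_dot pc (R_row pc) (phi pc wc (j - 1)) - xhat l s t $ i) \<and>
              \<bar>zeta v l s k t i j\<bar> \<le> lam v l)))"

definition aux_objective ::
    "nat \<Rightarrow> (nat \<Rightarrow> real) \<Rightarrow> (nat \<Rightarrow> real) \<Rightarrow> (nat \<Rightarrow> nat) \<Rightarrow> 'n aux_vars \<Rightarrow> real" where
  "aux_objective L prb \<theta> N v =
     (\<Sum>l=1..L. prb l * (lam v l * \<theta> l + 1 / real (N l) * (\<Sum>s=1..N l. eta v l s)))"

end

theory Submission
  imports Defs
begin

text \<open>
  Conditioning on the scenario splits the worst-case expectation into one problem per scenario: a
  measure on trajectories and scenarios with scenario probabilities \<open>prb l\<close> is determined by its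
  conditional laws, and the ambiguity set constrains each of them separately. So everything rests on
  the worst case of the reward \<open>f = max\<^sub>k (d\<^sub>k \<bullet> G(\<xi>) + r\<^sub>k)\<close> over a Wasserstein ball of radius \<open>\<theta>\<close>
  around an empirical distribution with samples \<open>y\<^sub>s\<close>, and on a finite description of its dual
  problem: minimise \<open>\<rho> \<theta> + 1/N \<Sum>\<^sub>s \<eta>\<^sub>s\<close> over \<open>\<rho> \<ge> 0\<close> and \<open>\<eta>\<close> subject to
  \<open>f(\<xi>) \<le> \<eta>\<^sub>s + \<rho> \<parallel>\<xi> - y\<^sub>s\<parallel>\<^sub>1\<close> for all \<open>s\<close> and all \<open>\<xi>\<close> in the support.

  \<^emph>\<open>Duality\<close> (\<open>integral_le_on_wasserstein_ball\<close>, \<open>nearly_optimal_mixture\<close>). Integrating the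
  constraint along a coupling gives that the dual value is an upper bound. The reward jumps at the
  breakpoints, so a worst-case distribution need not exist and compactness is of no help. Instead,
  the bound is approached by laws that send sample \<open>s\<close> to one of only two points, with the same
  probability for all samples. For mixtures of two transport plans with a single budget constraint,
  the multiplier \<open>\<rho>\<close> can be found by comparing slopes (\<open>two_point_multiplier\<close>); the positive radius
  supplies the Slater point, namely the plan that does not move anything.

  \<^emph>\<open>Finite description\<close> (\<open>sample_constraints_iff\<close>). The dual constraint for \<open>s\<close> says that for each
  \<open>k\<close> a sum of functions of the single components is bounded on a box; it holds iff bounds for the
  single components exist whose sum is small enough. In one component, the lifted vector is affine on
  each piece \<open>[w\<^sub>j\<^sub>-\<^sub>1, w\<^sub>j)\<close>, with limit \<open>\<phi>\<^sup>-\<^sub>j\<close> at the right end (\<open>lift_comp_on_piece\<close>). There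
  \<open>- \<rho> \<bar>x - y\<bar>\<close> is the minimum of \<open>- \<zeta> (x - y)\<close> over \<open>\<bar>\<zeta>\<bar> \<le> \<rho>\<close>, and exchanging this minimum with the
  supremum over the piece leaves an affine function of \<open>x\<close>, to be tested at the two ends only
  (\<open>separating_slope\<close>). This is the constraint on \<open>\<zeta>\<close> in the reformulation.
\<close>

section \<open>One component: the lifting on the pieces of its support\<close>

lemma mono_on_steps:
  fixes w :: "nat \<Rightarrow> 'a::order"
  assumes "\<And>j. j \<in> {1..p} \<Longrightarrow> w (j - 1) \<le> w j"
  shows "mono_on {..p} w"
proof (rule mono_onI)
  fix i j assume "i \<le> j" "j \<in> {..p}"
  then show "w i \<le> w j"
  proof (induction j rule: dec_induct)
    case (step j)
    then show ?case using assms[of "Suc j"] by (auto intro: order_trans)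
  qed simp
qed

lemma tendsto_V_part: "((\<lambda>x. V_part w x j) \<longlongrightarrow> V_part w y j) (at y within S)"
  unfolding V_part_def by (auto intro!: tendsto_intros)

lemma tendsto_Q_part_left:
  "((\<lambda>x. Q_part w x j) \<longlongrightarrow> (if w j < y then 1 else 0)) (at_left y)"
proof (cases "w j < y")
  case True
  have "eventually (\<lambda>x. x \<in> {w j<..<y}) (at_left y)"
    using True by (rule eventually_at_left_real)
  then have "eventually (\<lambda>x. Q_part w x j = 1) (at_left y)"
    by (rule eventually_mono) (auto simp: Q_part_def)
  then show ?thesis using True by (simp add: tendsto_eventually)
next
  case False
  have "eventually (\<lambda>x. x < y) (at_left y)"
    by (simp add: eventually_at_filter)
  then have "eventually (\<lambda>x. Q_part w x j = 0) (at_left y)"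
    by (rule eventually_mono) (use False in \<open>auto simp: Q_part_def\<close>)
  then show ?thesis using False by (simp add: tendsto_eventually)
qed

lemma tendsto_lift_comp_left:
  "((\<lambda>x. lift_comp p w x m) \<longlongrightarrow>
     (if m \<le> p then V_part w y m else if w (m - p) < y then 1 else 0)) (at_left y)"
  using tendsto_V_part[of w m y] tendsto_Q_part_left[of w "m - p" y]
  by (cases "m \<le> p") (simp_all add: lift_comp_def)

lemma phi_minus_eq:
  assumes "w 0 < w j"
  shows "phi_minus p w j m =
    (if m \<le> p then V_part w (w j) m else if w (m - p) < w j then 1 else 0)"
  using assms tendsto_Lim[OF _ tendsto_lift_comp_left[of p w m "w j"]]
  by (simp add: phi_minus_def)

lemma lift_dot_R_row:
  assumes "p \<ge> 1"
  shows "lift_dot p (R_row p) b = (\<Sum>m=1..p. b m)"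
proof -
  have "lift_dot p (R_row p) b = (\<Sum>m\<in>{1..p}. R_row p m * b m)"
    unfolding lift_dot_def using assms
    by (intro sum.mono_neutral_right) (auto simp: R_row_def)
  then show ?thesis by (simp add: R_row_def)
qed

text \<open>
  On nondecreasing breakpoints \<open>V_j\<close> is the increment of \<open>min x (w j)\<close>, so the sum telescopes.
\<close>

lemma sum_V_part:
  assumes "mono_on {..p} w" "1 \<le> n" "n \<le> p"
  shows "(\<Sum>m=1..n. V_part w x m) = min x (w n)"
  using assms(2,3)
proof (induction n rule: dec_induct)
  case base
  then show ?case by (simp add: V_part_def)
next
  case (step n)
  have "w n \<le> w (Suc n)"
    using assms(1) step by (auto intro: mono_onD)
  then show ?case using step by (simp add: V_part_def)
qed

lemma R_row_phi:
  assumes "mono_on {..p} w" "p \<ge> 1" "j \<le> p"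
  shows "lift_dot p (R_row p) (phi p w j) = w j"
proof -
  have "w j \<le> w p" using assms by (auto intro: mono_onD)
  then show ?thesis
    using sum_V_part[OF assms(1), of p] assms
    by (simp add: lift_dot_R_row phi_def lift_comp_def)
qed

lemma R_row_phi_minus:
  assumes "mono_on {..p} w" "p \<ge> 1" "j \<le> p"
  shows "lift_dot p (R_row p) (phi_minus p w j) = w j"
proof -
  have "phi_minus p w j m = phi p w j m" if "m \<in> {1..p}" for m
    using that
    by (cases "w 0 < w j") (simp add: phi_minus_eq phi_def lift_comp_def, simp add: phi_minus_def phi_def)
  then show ?thesis
    using R_row_phi[OF assms] assms(2) by (simp add: lift_dot_R_row)
qed

text \<open>
  On a half-open piece no \<open>Q\<close>-coordinate jumps and every \<open>V\<close>-coordinate is affine, so the lifted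
  vector interpolates between its value at the left end point and its left limit at the right end
  point. On the last piece this includes the right end point, since the last breakpoint has
  no \<open>Q\<close>-coordinate.
\<close>

lemma lift_comp_on_piece:
  assumes mono: "mono_on {..p} w" and j: "j \<in> {1..p}"
    and piece: "w (j - 1) < w j" "w (j - 1) \<le> x" "x < w j \<or> x = w j \<and> j = p"
    and m: "m \<in> {1..2 * p - 1}"
  shows "(w j - w (j - 1)) * lift_comp p w x m
       = (x - w (j - 1)) * phi_minus p w j m + (w j - x) * phi p w (j - 1) m"
proof -
  have le: "w i \<le> w k" if "i \<le> k" "k \<le> p" for i k
    using mono that by (auto intro: mono_onD)
  have pos: "w 0 < w j"
    using le[of 0 "j - 1"] j piece(1) by (simp add: le_diff_conv)
  show ?thesis
  proof (cases "m \<le> p")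
    case True
    consider "m < j" | "m = j" | "m > j" by linarith
    then have "(w j - w (j - 1)) * V_part w x m
      = (x - w (j - 1)) * V_part w (w j) m + (w j - x) * V_part w (w (j - 1)) m"
    proof cases
      case 1
      have "w m \<le> w (j - 1)" "w (m - 1) \<le> w m" using 1 le[of m "j - 1"] le[of "m - 1" m] j by auto
      then have "V_part w x m = V_part w (w (j - 1)) m" "V_part w (w j) m = V_part w (w (j - 1)) m"
        using piece by (auto simp: V_part_def min_def)
      then show ?thesis by (simp add: algebra_simps)
    next
      case 2
      then show ?thesis using piece by (auto simp: V_part_def algebra_simps min_def)
    next
      case 3
      have "w j \<le> w (m - 1)" "w (m - 1) \<le> w m" "m \<noteq> 1"
        using 3 le[of j "m - 1"] le[of "m - 1" m] j True by auto
      then show ?thesis using piece by (auto simp: V_part_def algebra_simps min_def)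
    qed
    then show ?thesis using True pos by (simp add: phi_minus_eq phi_def lift_comp_def)
  next
    case False
    then have k: "m - p \<ge> 1" "m - p \<le> p - 1" using m by auto
    show ?thesis
    proof (cases "m - p < j")
      case True
      then have "w (m - p) \<le> w (j - 1)" using le j by auto
      then show ?thesis using False piece pos
        by (auto simp: phi_minus_eq phi_def lift_comp_def Q_part_def)
    next
      case False'': False
      then have "w j \<le> w (m - p)" "j \<noteq> p" using le[of j "m - p"] k by auto
      then show ?thesis using False piece pos
        by (auto simp: phi_minus_eq phi_def lift_comp_def Q_part_def)
    qed
  qed
qed

lemma lift_dot_on_piece:
  assumes "mono_on {..p} w" "j \<in> {1..p}"
    and "w (j - 1) < w j" "w (j - 1) \<le> x" "x < w j \<or> x = w j \<and> j = p"
  shows "(w j - w (j - 1)) * lift_dot p a (lift_comp p w x)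
       = (x - w (j - 1)) * lift_dot p a (phi_minus p w j)
         + (w j - x) * lift_dot p a (phi p w (j - 1))"
proof -
  have "(w j - w (j - 1)) * (a m * lift_comp p w x m)
      = (x - w (j - 1)) * (a m * phi_minus p w j m) + (w j - x) * (a m * phi p w (j - 1) m)"
    if "m \<in> {1..2 * p - 1}" for m
  proof -
    have "(w j - w (j - 1)) * (a m * lift_comp p w x m)
        = a m * ((w j - w (j - 1)) * lift_comp p w x m)" by simp
    also have "\<dots> = a m * ((x - w (j - 1)) * phi_minus p w j m + (w j - x) * phi p w (j - 1) m)"
      by (simp only: lift_comp_on_piece[OF assms that])
    finally show ?thesis by (simp add: algebra_simps)
  qed
  then show ?thesis
    unfolding lift_dot_def by (simp add: sum_distrib_left sum.distrib[symmetric])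
qed

text \<open>
  The second case is for the right end point of the support when the last piece is degenerate, so
  that the left limit there does not give the value at this point.
\<close>

lemma exists_piece:
  fixes w :: "nat \<Rightarrow> real"
  assumes "mono_on {..p} w" "p \<ge> 1" "w 0 \<le> x" "x \<le> w p"
  obtains j where "j \<in> {1..p}" "w (j - 1) < w j" "w (j - 1) \<le> x" "x < w j \<or> x = w j \<and> j = p"
    | j where "j \<in> {1..p}" "x = w (j - 1)"
proof (cases "x = w p")
  case True
  have "w (p - 1) \<le> w p" using assms by (auto intro: mono_onD)
  then show ?thesis using that(1)[of p] that(2)[of p] True assms by force
next
  case False
  define j where "j = (LEAST j. x < w j)"
  have lt: "x < w p" using False assms by simp
  then have j: "x < w j" unfolding j_def by (rule LeastI)
  have "j \<le> p" unfolding j_def using lt by (rule Least_le)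
  moreover have "j \<noteq> 0" using j assms(3) by (metis not_le)
  moreover have "\<not> x < w (j - 1)"
    using not_less_Least[of "j - 1" "\<lambda>j. x < w j"] \<open>j \<noteq> 0\<close> unfolding j_def by simp
  ultimately show ?thesis using that(1)[of j] j by auto
qed

text \<open>
  The left limit is a limit of lifted vectors of points of the support, which is where
  \<open>w 0 < w j\<close> matters; the other case is evaluated at the point itself.
\<close>

lemma lift_dot_phi_minus_le:
  assumes mono: "mono_on {..p} w" and j: "j \<in> {1..p}"
    and bound: "\<And>x. x \<in> {w 0..w p} \<Longrightarrow> lift_dot p a (lift_comp p w x) \<le> F x"
    and cont: "isCont F (w j)"
  shows "lift_dot p a (phi_minus p w j) \<le> F (w j)"
proof (cases "w 0 < w j")
  case True
  have wj: "w j \<le> w p" using mono j by (auto intro: mono_onD)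
  have "((\<lambda>x. lift_dot p a (lift_comp p w x)) \<longlongrightarrow> lift_dot p a (phi_minus p w j)) (at_left (w j))"
    unfolding lift_dot_def phi_minus_eq[OF True]
    by (intro tendsto_sum tendsto_mult tendsto_const tendsto_lift_comp_left)
  moreover have "(F \<longlongrightarrow> F (w j)) (at_left (w j))"
    using cont by (auto simp: isCont_def intro: tendsto_within_subset)
  moreover have "eventually (\<lambda>x. lift_dot p a (lift_comp p w x) \<le> F x) (at_left (w j))"
    using eventually_at_left_real[OF True] by (rule eventually_mono) (use bound wj in auto)
  ultimately show ?thesis by (intro tendsto_le) auto
next
  case False
  have "w 0 \<le> w j" "w j \<le> w p" using mono j by (auto intro: mono_onD)
  then have "lift_dot p a (lift_comp p w (w j)) \<le> F (w j)" using bound by auto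
  then show ?thesis using False by (simp add: lift_dot_def phi_minus_def)
qed

text \<open>
  This is minimax duality on one piece: an affine function with values \<open>\<alpha>\<close> at \<open>u\<close> and \<open>\<beta>\<close> at \<open>v\<close>
  lies below \<open>e + \<rho> * \<bar>x - y\<bar>\<close> on \<open>[v, u]\<close> iff one slope \<open>z\<close> separates the two. As
  the difference of the two is affine on either side of \<open>y\<close>, only \<open>u\<close>, \<open>v\<close> and \<open>y\<close> have to be tested.
\<close>

lemma separating_slope:
  fixes u v y e \<rho> \<alpha> \<beta> :: real
  assumes "v \<le> u" "\<rho> \<ge> 0"
    and u: "\<alpha> \<le> e + \<rho> * \<bar>u - y\<bar>" and v: "\<beta> \<le> e + \<rho> * \<bar>v - y\<bar>"
    and mid: "v < y \<Longrightarrow> y < u \<Longrightarrow> (y - v) * \<alpha> + (u - y) * \<beta> \<le> (u - v) * e"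
  obtains z where "\<alpha> - z * (u - y) \<le> e" "\<beta> - z * (v - y) \<le> e" "\<bar>z\<bar> \<le> \<rho>"
proof -
  consider "y \<le> v" | "u \<le> y" | "v < y" "y < u" by linarith
  then show ?thesis
  proof cases
    case 1
    then show ?thesis using that[of \<rho>] assms by (simp add: algebra_simps)
  next
    case 2
    then show ?thesis using that[of "- \<rho>"] assms by (simp add: algebra_simps)
  next
    case 3
    define z where "z = max (- \<rho>) ((\<alpha> - e) / (u - y))"
    have "(\<alpha> - e) / (u - y) \<le> \<rho>" using 3 u by (simp add: divide_simps algebra_simps)
    then have "\<bar>z\<bar> \<le> \<rho>" using assms(2) by (auto simp: z_def)
    moreover have "\<alpha> - e \<le> z * (u - y)"
    proof -
      have "(\<alpha> - e) / (u - y) \<le> z" by (simp add: z_def)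
      then show ?thesis using 3 by (simp add: pos_divide_le_eq)
    qed
    moreover have "z \<le> (e - \<beta>) / (y - v)"
    proof -
      have "- \<rho> \<le> (e - \<beta>) / (y - v)" using 3 v by (simp add: divide_simps algebra_simps)
      moreover have "(\<alpha> - e) / (u - y) \<le> (e - \<beta>) / (y - v)"
        using 3 mid by (simp add: divide_simps algebra_simps)
      ultimately show ?thesis by (simp add: z_def)
    qed
    then have "z * (y - v) \<le> e - \<beta>" using 3 by (simp add: pos_le_divide_eq)
    ultimately show ?thesis using that[of z] by (simp add: algebra_simps)
  qed
qed

text \<open>
  On a piece the reward is affine up to its limit at the right end, so that \<open>separating_slope\<close> yields
  the line of slope \<open>z\<close> through \<open>(y, e)\<close> above it. Conversely, a line above both end values is above
  the whole piece, and a slope of at most \<open>\<rho>\<close> keeps it below \<open>e + \<rho> * \<bar>x - y\<bar>\<close>.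
\<close>

lemma component_bound_iff:
  assumes mono: "mono_on {..p} w" and p: "p \<ge> 1" and \<rho>: "\<rho> \<ge> 0"
  shows "(\<forall>x\<in>{w 0..w p}. lift_dot p a (lift_comp p w x) \<le> e + \<rho> * \<bar>x - y\<bar>) \<longleftrightarrow>
    (\<forall>j\<in>{1..p}. \<exists>z.
       e \<ge> lift_dot p a (phi_minus p w j) - z * (lift_dot p (R_row p) (phi_minus p w j) - y) \<and>
       e \<ge> lift_dot p a (phi p w (j - 1)) - z * (lift_dot p (R_row p) (phi p w (j - 1)) - y) \<and>
       \<bar>z\<bar> \<le> \<rho>)" (is "?bound \<longleftrightarrow> ?constr")
proof
  have R: "lift_dot p (R_row p) (phi_minus p w j) = w j"
    "lift_dot p (R_row p) (phi p w (j - 1)) = w (j - 1)" if "j \<in> {1..p}" for j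
    using R_row_phi_minus[OF mono p] R_row_phi[OF mono p] that by auto
  have le: "w i \<le> w k" if "i \<le> k" "k \<le> p" for i k
    using mono that by (auto intro: mono_onD)
  {
    assume bound: ?bound
    show ?constr
    proof
      fix j assume j: "j \<in> {1..p}"
      have 1: "lift_dot p a (phi_minus p w j) \<le> e + \<rho> * \<bar>w j - y\<bar>"
        by (rule lift_dot_phi_minus_le[where F = "\<lambda>x. e + \<rho> * \<bar>x - y\<bar>", OF mono j])
           (use bound in auto)
      have 2: "lift_dot p a (phi p w (j - 1)) \<le> e + \<rho> * \<bar>w (j - 1) - y\<bar>"
      proof -
        have "w 0 \<le> w (j - 1)" "w (j - 1) \<le> w p" using j by (intro le; force)+
        then show ?thesis using bound by (simp add: phi_def)
      qed
      have 3: "(y - w (j - 1)) * lift_dot p a (phi_minus p w j)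
            + (w j - y) * lift_dot p a (phi p w (j - 1)) \<le> (w j - w (j - 1)) * e"
        if y: "w (j - 1) < y" "y < w j"
      proof -
        have "lift_dot p a (lift_comp p w y) \<le> e"
        proof -
          have "w 0 \<le> w (j - 1)" "w j \<le> w p" using j by (intro le; force)+
          then show ?thesis using bound[rule_format, of y] y by simp
        qed
        then have "(w j - w (j - 1)) * lift_dot p a (lift_comp p w y) \<le> (w j - w (j - 1)) * e"
          using y by (intro mult_left_mono) auto
        then show ?thesis using lift_dot_on_piece[OF mono j, of y a] y by simp
      qed
      obtain z where
        "lift_dot p a (phi_minus p w j) - z * (w j - y) \<le> e"
        "lift_dot p a (phi p w (j - 1)) - z * (w (j - 1) - y) \<le> e" "\<bar>z\<bar> \<le> \<rho>"
        using separating_slope[OF le[of "j - 1" j] \<rho> 1 2 3] j by auto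
      then show "\<exists>z. e \<ge> lift_dot p a (phi_minus p w j)
                      - z * (lift_dot p (R_row p) (phi_minus p w j) - y) \<and>
                  e \<ge> lift_dot p a (phi p w (j - 1))
                      - z * (lift_dot p (R_row p) (phi p w (j - 1)) - y) \<and> \<bar>z\<bar> \<le> \<rho>"
        unfolding R[OF j] by blast
    qed
  }
  {
    assume constr: ?constr
    have slope: "z * (x - y) \<le> \<rho> * \<bar>x - y\<bar>" if "\<bar>z\<bar> \<le> \<rho>" for z x
      using mult_right_mono[OF that, of "\<bar>x - y\<bar>"] by (simp add: abs_mult[symmetric])
    show ?bound
    proof
      fix x assume x: "x \<in> {w 0..w p}"
      have constr': "\<exists>z. lift_dot p a (phi_minus p w j) - z * (w j - y) \<le> e \<and>
         lift_dot p a (phi p w (j - 1)) - z * (w (j - 1) - y) \<le> e \<and> \<bar>z\<bar> \<le> \<rho>"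
        if "j \<in> {1..p}" for j
        using constr[rule_format, OF that] unfolding R[OF that] .
      from x have "w 0 \<le> x" "x \<le> w p" by auto
      then consider
          j where "j \<in> {1..p}" "w (j - 1) < w j" "w (j - 1) \<le> x" "x < w j \<or> x = w j \<and> j = p"
        | j where "j \<in> {1..p}" "x = w (j - 1)"
        using exists_piece[OF mono p] by metis
      then show "lift_dot p a (lift_comp p w x) \<le> e + \<rho> * \<bar>x - y\<bar>"
      proof cases
        case (1 j)
        obtain z where z: "lift_dot p a (phi_minus p w j) \<le> e + z * (w j - y)"
          "lift_dot p a (phi p w (j - 1)) \<le> e + z * (w (j - 1) - y)" "\<bar>z\<bar> \<le> \<rho>"
          using constr'[OF 1(1)] by (auto simp: algebra_simps)
        have "(w j - w (j - 1)) * lift_dot p a (lift_comp p w x)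
            \<le> (x - w (j - 1)) * (e + z * (w j - y)) + (w j - x) * (e + z * (w (j - 1) - y))"
          unfolding lift_dot_on_piece[OF mono 1]
          using 1 z by (intro add_mono mult_left_mono) auto
        also have "\<dots> = (w j - w (j - 1)) * (e + z * (x - y))" by (simp add: algebra_simps)
        finally have "lift_dot p a (lift_comp p w x) \<le> e + z * (x - y)"
          using 1 by simp
        then show ?thesis using slope[OF z(3), of x] by simp
      next
        case (2 j)
        obtain z where "lift_dot p a (phi p w (j - 1)) - z * (w (j - 1) - y) \<le> e" "\<bar>z\<bar> \<le> \<rho>"
          using constr'[OF 2(1)] by blast
        then show ?thesis using 2(2) slope[of z x] by (simp add: phi_def)
      qed
    qed
  }
qed

lemma bounded_lift_dot:
  obtains b where "\<And>x. x \<in> {u..v} \<Longrightarrow> \<bar>lift_dot p a (lift_comp p w x)\<bar> \<le> b"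
proof
  fix x assume x: "x \<in> {u..v}"
  have "\<bar>lift_comp p w x m\<bar> \<le> \<bar>u\<bar> + \<bar>v\<bar> + \<bar>w m\<bar> + \<bar>w (m - 1)\<bar> + \<bar>w 1\<bar> + 1" for m
    using x by (auto simp: lift_comp_def V_part_def Q_part_def)
  then have "\<bar>a m * lift_comp p w x m\<bar> \<le> \<bar>a m\<bar> * (\<bar>u\<bar> + \<bar>v\<bar> + \<bar>w m\<bar> + \<bar>w (m - 1)\<bar> + \<bar>w 1\<bar> + 1)" for m
    by (simp add: abs_mult mult_left_mono)
  then show "\<bar>lift_dot p a (lift_comp p w x)\<bar>
    \<le> (\<Sum>m=1..2*p-1. \<bar>a m\<bar> * (\<bar>u\<bar> + \<bar>v\<bar> + \<bar>w m\<bar> + \<bar>w (m - 1)\<bar> + \<bar>w 1\<bar> + 1))"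
    unfolding lift_dot_def by (intro order_trans[OF sum_abs] sum_mono)
qed

section \<open>Suprema of separable functions\<close>

text \<open>The arguments \<open>x i\<close> range independently, so the suprema can be taken one after the other.\<close>

lemma sum_SUP_le:
  fixes F :: "'i \<Rightarrow> 'a \<Rightarrow> real"
  assumes "finite I" "\<And>i. i \<in> I \<Longrightarrow> S i \<noteq> {}"
    and "\<And>x. (\<And>i. i \<in> I \<Longrightarrow> x i \<in> S i) \<Longrightarrow> (\<Sum>i\<in>I. F i (x i)) \<le> e"
  shows "(\<Sum>i\<in>I. SUP x\<in>S i. F i x) \<le> e"
  using assms
proof (induction I arbitrary: e rule: finite_induct)
  case empty
  then show ?case by simp
next
  case (insert i I)
  have "F i y \<le> e - (\<Sum>i\<in>I. SUP x\<in>S i. F i x)" if y: "y \<in> S i" for y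
  proof -
    have "(\<Sum>i\<in>I. SUP x\<in>S i. F i x) \<le> e - F i y"
    proof (rule insert.IH)
      fix x assume "\<And>i. i \<in> I \<Longrightarrow> x i \<in> S i"
      then have "(\<Sum>k\<in>insert i I. F k ((x(i := y)) k)) \<le> e"
        using y insert.hyps by (intro insert.prems) auto
      also have "(\<Sum>k\<in>insert i I. F k ((x(i := y)) k)) = F i y + (\<Sum>k\<in>I. F k (x k))"
        using insert.hyps by (auto intro!: sum.cong)
      finally show "(\<Sum>k\<in>I. F k (x k)) \<le> e - F i y" by simp
    qed (use insert.prems in auto)
    then show ?thesis by simp
  qed
  then have "(SUP x\<in>S i. F i x) \<le> e - (\<Sum>i\<in>I. SUP x\<in>S i. F i x)"
    using insert.prems(1)[of i] by (intro cSUP_least) auto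
  then show ?case using insert.hyps by simp
qed

section \<open>One sample: the penalised reward on the support\<close>

definition reward ::
    "nat \<Rightarrow> nat \<Rightarrow> (nat \<Rightarrow> 'n \<Rightarrow> nat) \<Rightarrow> (nat \<Rightarrow> 'n \<Rightarrow> nat \<Rightarrow> real) \<Rightarrow>
     (nat \<Rightarrow> nat \<Rightarrow> 'n \<Rightarrow> nat \<Rightarrow> real) \<Rightarrow> (nat \<Rightarrow> real) \<Rightarrow> ('n::finite) trajectory \<Rightarrow> real" where
  "reward T K p w d r \<xi> = (MAX k\<in>{1..K}. full_dot T p w (d k) \<xi> + r k)"

text \<open>
  Both the linear pieces of the reward and the transport cost are sums over the components, and the
  support is a product; hence the supremum of their difference splits into one supremum per
  component.
\<close>

lemma full_dot_bound_iff:
  fixes y :: "('n::finite) trajectory"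
  assumes mono: "\<And>t i. t \<in> {1..T} \<Longrightarrow> mono_on {..p t i} (w t i)"
    and p: "\<And>t i. t \<in> {1..T} \<Longrightarrow> p t i \<ge> 1"
    and lo: "\<And>t i. t \<in> {1..T} \<Longrightarrow> w t i 0 = lo t i"
    and hi: "\<And>t i. t \<in> {1..T} \<Longrightarrow> w t i (p t i) = hi t i"
    and \<rho>: "\<rho> \<ge> 0"
  shows "(\<forall>\<xi>\<in>support_box T lo hi. full_dot T p w d \<xi> \<le> e + \<rho> * norm1_dist T \<xi> y) \<longleftrightarrow>
    (\<exists>h. e \<ge> (\<Sum>t=1..T. \<Sum>i\<in>UNIV. h t i) \<and>
       (\<forall>t\<in>{1..T}. \<forall>i. \<forall>x\<in>{w t i 0..w t i (p t i)}.
          lift_dot (p t i) (d t i) (lift_comp (p t i) (w t i) x) \<le> h t i + \<rho> * \<bar>x - y t $ i\<bar>))"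
    (is "?bound \<longleftrightarrow> (\<exists>h. e \<ge> ?sum h \<and> ?comp h)")
proof
  define F where "F = (\<lambda>(t, i) x.
    lift_dot (p t i) (d t i) (lift_comp (p t i) (w t i) x) - \<rho> * \<bar>x - y t $ i\<bar>)"
  define S where "S = (\<lambda>(t, i). {w t i 0..w t i (p t i)})"
  have total: "full_dot T p w d \<xi> - \<rho> * norm1_dist T \<xi> y
      = (\<Sum>q\<in>{1..T} \<times> UNIV. F q (\<xi> (fst q) $ snd q))" for \<xi>
    unfolding full_dot_def norm1_dist_def F_def
    by (simp add: sum.cartesian_product' sum_subtractf sum_distrib_left split_def)
  {
    assume bound: ?bound
    have nonempty: "S q \<noteq> {}" if "q \<in> {1..T} \<times> UNIV" for q
    proof -
      obtain t i where q: "q = (t, i)" by (cases q)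
      have "w t i 0 \<le> w t i (p t i)" using mono[of t i] that q by (auto intro: mono_onD)
      then show ?thesis by (auto simp: S_def q)
    qed
    have "(\<Sum>q\<in>{1..T} \<times> (UNIV :: 'n set). SUP x\<in>S q. F q x) \<le> e"
    proof (rule sum_SUP_le)
      fix x :: "nat \<times> 'n \<Rightarrow> real"
      assume x: "\<And>q. q \<in> {1..T} \<times> (UNIV :: 'n set) \<Longrightarrow> x q \<in> S q"
      define \<xi> :: "'n trajectory" where "\<xi> = restrict (\<lambda>t. \<chi> i. x (t, i)) {1..T}"
      have "\<xi> \<in> space (traj_space T)"
        by (auto simp: traj_space_def space_PiM \<xi>_def)
      moreover have "lo t i \<le> \<xi> t $ i \<and> \<xi> t $ i \<le> hi t i" if "t \<in> {1..T}" for t i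
        using x[of "(t, i)"] that lo[OF that, of i] hi[OF that, of i]
        by (auto simp: \<xi>_def S_def)
      ultimately have "\<xi> \<in> support_box T lo hi" by (simp add: support_box_def)
      then have "full_dot T p w d \<xi> - \<rho> * norm1_dist T \<xi> y \<le> e"
        using bound by (simp add: algebra_simps)
      moreover have "(\<Sum>q\<in>{1..T} \<times> UNIV. F q (\<xi> (fst q) $ snd q)) = (\<Sum>q\<in>{1..T} \<times> UNIV. F q (x q))"
        by (intro sum.cong) (auto simp: \<xi>_def)
      ultimately show "(\<Sum>q\<in>{1..T} \<times> UNIV. F q (x q)) \<le> e"
        unfolding total by simp
    qed (use nonempty in auto)
    then have "?sum (\<lambda>t i. SUP x\<in>S (t, i). F (t, i) x) \<le> e"
      by (simp add: sum.cartesian_product')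
    moreover have "?comp (\<lambda>t i. SUP x\<in>S (t, i). F (t, i) x)"
    proof (intro ballI allI)
      fix t i x assume t: "t \<in> {1..T}" and x: "x \<in> {w t i 0..w t i (p t i)}"
      obtain b where b: "\<And>x. x \<in> {w t i 0..w t i (p t i)} \<Longrightarrow>
          \<bar>lift_dot (p t i) (d t i) (lift_comp (p t i) (w t i) x)\<bar> \<le> b"
        using bounded_lift_dot[of "w t i 0" "w t i (p t i)" "p t i" "d t i" "w t i"] by auto
      have "F (t, i) x' \<le> b" if x': "x' \<in> S (t, i)" for x'
      proof -
        have "lift_dot (p t i) (d t i) (lift_comp (p t i) (w t i) x') \<le> b"
          using b[of x'] x' by (auto simp: S_def)
        moreover have "0 \<le> \<rho> * \<bar>x' - y t $ i\<bar>" using \<rho> by simp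
        ultimately show ?thesis by (simp add: F_def)
      qed
      then have "bdd_above (F (t, i) ` S (t, i))" by (rule bdd_aboveI2)
      then have "F (t, i) x \<le> (SUP x\<in>S (t, i). F (t, i) x)"
        using x by (intro cSUP_upper) (auto simp: S_def)
      then show "lift_dot (p t i) (d t i) (lift_comp (p t i) (w t i) x)
          \<le> (SUP x\<in>S (t, i). F (t, i) x) + \<rho> * \<bar>x - y t $ i\<bar>"
        by (simp add: F_def)
    qed
    ultimately show "\<exists>h. e \<ge> ?sum h \<and> ?comp h" by (intro exI conjI)
  }
  {
    assume "\<exists>h. e \<ge> ?sum h \<and> ?comp h"
    then obtain h where h: "e \<ge> ?sum h" "?comp h" by blast
    show ?bound
    proof
      fix \<xi> assume "\<xi> \<in> support_box T lo hi"
      then have \<xi>: "\<xi> t $ i \<in> {w t i 0..w t i (p t i)}" if "t \<in> {1..T}" for t i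
        using that lo[OF that, of i] hi[OF that, of i] by (auto simp: support_box_def)
      have "full_dot T p w d \<xi> \<le> (\<Sum>t=1..T. \<Sum>i\<in>UNIV. h t i + \<rho> * \<bar>\<xi> t $ i - y t $ i\<bar>)"
        unfolding full_dot_def using h(2) \<xi> by (intro sum_mono) auto
      also have "\<dots> = ?sum h + \<rho> * norm1_dist T \<xi> y"
        by (simp add: norm1_dist_def sum.distrib sum_distrib_left)
      finally show "full_dot T p w d \<xi> \<le> e + \<rho> * norm1_dist T \<xi> y" using h(1) by simp
    qed
  }
qed

text \<open>
  The constraints belonging to one sample: with \<open>h\<close> and \<open>z\<close> for \<open>eta_comp\<close> and \<open>zeta\<close>, they are
  solvable iff \<open>e\<close> bounds the penalised reward on the whole support.
\<close>

definition sample_constraints ::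
    "nat \<Rightarrow> nat \<Rightarrow> (nat \<Rightarrow> 'n \<Rightarrow> nat) \<Rightarrow> (nat \<Rightarrow> 'n \<Rightarrow> nat \<Rightarrow> real) \<Rightarrow>
     (nat \<Rightarrow> nat \<Rightarrow> 'n \<Rightarrow> nat \<Rightarrow> real) \<Rightarrow> (nat \<Rightarrow> real) \<Rightarrow> ('n::finite) trajectory \<Rightarrow> real \<Rightarrow> real \<Rightarrow>
     (nat \<Rightarrow> nat \<Rightarrow> 'n \<Rightarrow> real) \<Rightarrow> (nat \<Rightarrow> nat \<Rightarrow> 'n \<Rightarrow> nat \<Rightarrow> real) \<Rightarrow> bool" where
  "sample_constraints T K p w d r y \<rho> e h z \<longleftrightarrow>
     (\<forall>k\<in>{1..K}. e \<ge> (\<Sum>t=1..T. \<Sum>i\<in>UNIV. h k t i) + r k \<and>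
        (\<forall>t\<in>{1..T}. \<forall>i. \<forall>j\<in>{1..p t i}.
           h k t i \<ge> lift_dot (p t i) (d k t i) (phi_minus (p t i) (w t i) j)
             - z k t i j * (lift_dot (p t i) (R_row (p t i)) (phi_minus (p t i) (w t i) j) - y t $ i) \<and>
           h k t i \<ge> lift_dot (p t i) (d k t i) (phi (p t i) (w t i) (j - 1))
             - z k t i j * (lift_dot (p t i) (R_row (p t i)) (phi (p t i) (w t i) (j - 1)) - y t $ i) \<and>
           \<bar>z k t i j\<bar> \<le> \<rho>))"

lemma aux_feasible_iff:
  "aux_feasible T L K N xhat p w d r v \<longleftrightarrow>
     (\<forall>l\<in>{1..L}. \<forall>s\<in>{1..N l}. sample_constraints T K (p l) (w l) (d l) (r l) (xhat l s)
        (lam v l) (eta v l s) (eta_comp v l s) (zeta v l s))"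
  by (simp add: aux_feasible_def sample_constraints_def Let_def)

lemma sample_constraints_iff:
  fixes y :: "('n::finite) trajectory"
  assumes mono: "\<And>t i. t \<in> {1..T} \<Longrightarrow> mono_on {..p t i} (w t i)"
    and p: "\<And>t i. t \<in> {1..T} \<Longrightarrow> p t i \<ge> 1"
    and lo: "\<And>t i. t \<in> {1..T} \<Longrightarrow> w t i 0 = lo t i"
    and hi: "\<And>t i. t \<in> {1..T} \<Longrightarrow> w t i (p t i) = hi t i"
    and \<rho>: "\<rho> \<ge> 0" and K: "K \<ge> 1"
  shows "(\<exists>h z. sample_constraints T K p w d r y \<rho> e h z) \<longleftrightarrow>
    (\<forall>\<xi>\<in>support_box T lo hi. reward T K p w d r \<xi> \<le> e + \<rho> * norm1_dist T \<xi> y)"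
proof -
  have "(\<forall>\<xi>\<in>support_box T lo hi. reward T K p w d r \<xi> \<le> e + \<rho> * norm1_dist T \<xi> y) \<longleftrightarrow>
    (\<forall>\<xi>\<in>support_box T lo hi. \<forall>k\<in>{1..K}.
       full_dot T p w (d k) \<xi> + r k \<le> e + \<rho> * norm1_dist T \<xi> y)"
    using K by (simp add: reward_def)
  also have "\<dots> \<longleftrightarrow> (\<forall>k\<in>{1..K}. \<forall>\<xi>\<in>support_box T lo hi.
       full_dot T p w (d k) \<xi> \<le> (e - r k) + \<rho> * norm1_dist T \<xi> y)"
    by (auto simp: algebra_simps)
  also have "\<dots> \<longleftrightarrow> (\<forall>k\<in>{1..K}. \<exists>h. e - r k \<ge> (\<Sum>t=1..T. \<Sum>i\<in>UNIV. h t i) \<and>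
       (\<forall>t\<in>{1..T}. \<forall>i. \<forall>x\<in>{w t i 0..w t i (p t i)}.
          lift_dot (p t i) (d k t i) (lift_comp (p t i) (w t i) x) \<le> h t i + \<rho> * \<bar>x - y t $ i\<bar>))"
    by (simp only: full_dot_bound_iff[OF mono p lo hi \<rho>])
  also have "\<dots> \<longleftrightarrow> (\<forall>k\<in>{1..K}. \<exists>h. e - r k \<ge> (\<Sum>t=1..T. \<Sum>i\<in>UNIV. h t i) \<and>
       (\<forall>t\<in>{1..T}. \<forall>i. \<forall>j\<in>{1..p t i}. \<exists>z.
           h t i \<ge> lift_dot (p t i) (d k t i) (phi_minus (p t i) (w t i) j)
             - z * (lift_dot (p t i) (R_row (p t i)) (phi_minus (p t i) (w t i) j) - y t $ i) \<and>
           h t i \<ge> lift_dot (p t i) (d k t i) (phi (p t i) (w t i) (j - 1))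
             - z * (lift_dot (p t i) (R_row (p t i)) (phi (p t i) (w t i) (j - 1)) - y t $ i) \<and>
           \<bar>z\<bar> \<le> \<rho>))"
    by (simp only: component_bound_iff[OF mono p \<rho>] cong: ball_cong)
  also have "\<dots> \<longleftrightarrow> (\<exists>h z. sample_constraints T K p w d r y \<rho> e h z)" (is "?l \<longleftrightarrow> _")
  proof
    assume ?l
    then obtain h where h: "\<forall>k\<in>{1..K}. e - r k \<ge> (\<Sum>t=1..T. \<Sum>i\<in>UNIV. h k t i) \<and>
       (\<forall>t\<in>{1..T}. \<forall>i. \<forall>j\<in>{1..p t i}. \<exists>z.
           h k t i \<ge> lift_dot (p t i) (d k t i) (phi_minus (p t i) (w t i) j)
             - z * (lift_dot (p t i) (R_row (p t i)) (phi_minus (p t i) (w t i) j) - y t $ i) \<and>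
           h k t i \<ge> lift_dot (p t i) (d k t i) (phi (p t i) (w t i) (j - 1))
             - z * (lift_dot (p t i) (R_row (p t i)) (phi (p t i) (w t i) (j - 1)) - y t $ i) \<and>
           \<bar>z\<bar> \<le> \<rho>)"
      unfolding bchoice_iff by blast
    have "\<forall>k t i j. \<exists>z. k \<in> {1..K} \<and> t \<in> {1..T} \<and> j \<in> {1..p t i} \<longrightarrow>
           h k t i \<ge> lift_dot (p t i) (d k t i) (phi_minus (p t i) (w t i) j)
             - z * (lift_dot (p t i) (R_row (p t i)) (phi_minus (p t i) (w t i) j) - y t $ i) \<and>
           h k t i \<ge> lift_dot (p t i) (d k t i) (phi (p t i) (w t i) (j - 1))
             - z * (lift_dot (p t i) (R_row (p t i)) (phi (p t i) (w t i) (j - 1)) - y t $ i) \<and>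
           \<bar>z\<bar> \<le> \<rho>"
      using h by blast
    then obtain z where "\<forall>k t i j. k \<in> {1..K} \<and> t \<in> {1..T} \<and> j \<in> {1..p t i} \<longrightarrow>
           h k t i \<ge> lift_dot (p t i) (d k t i) (phi_minus (p t i) (w t i) j)
             - z k t i j * (lift_dot (p t i) (R_row (p t i)) (phi_minus (p t i) (w t i) j) - y t $ i) \<and>
           h k t i \<ge> lift_dot (p t i) (d k t i) (phi (p t i) (w t i) (j - 1))
             - z k t i j * (lift_dot (p t i) (R_row (p t i)) (phi (p t i) (w t i) (j - 1)) - y t $ i) \<and>
           \<bar>z k t i j\<bar> \<le> \<rho>"
      unfolding choice_iff by blast
    with h have "sample_constraints T K p w d r y \<rho> e h z"
      unfolding sample_constraints_def by (simp add: algebra_simps)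
    then show "\<exists>h z. sample_constraints T K p w d r y \<rho> e h z" by blast
  next
    assume "\<exists>h z. sample_constraints T K p w d r y \<rho> e h z"
    then obtain h z where hz: "sample_constraints T K p w d r y \<rho> e h z" by blast
    show ?l
    proof (intro ballI exI conjI allI)
      fix k assume k: "k \<in> {1..K}"
      show "e - r k \<ge> (\<Sum>t=1..T. \<Sum>i\<in>UNIV. h k t i)"
        using hz k by (auto simp: sample_constraints_def algebra_simps)
      fix t i j assume "t \<in> {1..T}" "j \<in> {1..p t i}"
      with hz k show
        "h k t i \<ge> lift_dot (p t i) (d k t i) (phi_minus (p t i) (w t i) j)
             - z k t i j * (lift_dot (p t i) (R_row (p t i)) (phi_minus (p t i) (w t i) j) - y t $ i)"
        "h k t i \<ge> lift_dot (p t i) (d k t i) (phi (p t i) (w t i) (j - 1))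
             - z k t i j * (lift_dot (p t i) (R_row (p t i)) (phi (p t i) (w t i) (j - 1)) - y t $ i)"
        "\<bar>z k t i j\<bar> \<le> \<rho>"
        unfolding sample_constraints_def by blast+
    qed
  qed
  finally show ?thesis ..
qed

lemma sample_constraints_imp_nonneg:
  assumes "sample_constraints T K p w d r y \<rho> e h z" "K \<ge> 1" "T \<ge> 1" "p 1 i \<ge> 1"
  shows "\<rho> \<ge> 0"
proof -
  have "\<bar>z 1 1 i 1\<bar> \<le> \<rho>"
    using assms unfolding sample_constraints_def by (meson atLeastAtMost_iff order_refl)
  then show ?thesis by linarith
qed

lemma bounded_reward:
  fixes lo :: "nat \<Rightarrow> 'n::finite \<Rightarrow> real"
  assumes "K \<ge> 1"
  obtains b where "\<And>\<xi>. \<xi> \<in> support_box T lo hi \<Longrightarrow> \<bar>reward T K p w d r \<xi>\<bar> \<le> b"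
proof -
  have "\<forall>k t i. \<exists>b. \<forall>x\<in>{lo t i..hi t i}.
      \<bar>lift_dot (p t i) (d k t i) (lift_comp (p t i) (w t i) x)\<bar> \<le> b"
    using bounded_lift_dot by metis
  then obtain b where b: "\<And>k t i x. x \<in> {lo t i..hi t i} \<Longrightarrow>
      \<bar>lift_dot (p t i) (d k t i) (lift_comp (p t i) (w t i) x)\<bar> \<le> b k t i"
    unfolding choice_iff by blast
  define B where "B k = (\<Sum>t=1..T. \<Sum>i\<in>UNIV. b k t i) + \<bar>r k\<bar>" for k
  have B: "\<bar>full_dot T p w (d k) \<xi> + r k\<bar> \<le> B k" if "\<xi> \<in> support_box T lo hi" for k \<xi>
  proof -
    have "\<bar>full_dot T p w (d k) \<xi>\<bar> \<le> (\<Sum>t=1..T. \<Sum>i\<in>UNIV. b k t i)"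
      unfolding full_dot_def
      using that by (intro order_trans[OF sum_abs] sum_mono b) (auto simp: support_box_def)
    then show ?thesis by (simp add: B_def)
  qed
  show ?thesis
  proof (rule that)
    fix \<xi> assume \<xi>: "\<xi> \<in> support_box T lo hi"
    have "reward T K p w d r \<xi> \<in> (\<lambda>k. full_dot T p w (d k) \<xi> + r k) ` {1..K}"
      unfolding reward_def using assms by (intro Max_in) auto
    then obtain k where k: "k \<in> {1..K}" "reward T K p w d r \<xi> = full_dot T p w (d k) \<xi> + r k"
      by blast
    then have "\<bar>reward T K p w d r \<xi>\<bar> \<le> B k" using B[OF \<xi>] by simp
    also have "\<dots> \<le> (MAX k\<in>{1..K}. B k)" using k by (intro Max_ge) auto
    finally show "\<bar>reward T K p w d r \<xi>\<bar> \<le> (MAX k\<in>{1..K}. B k)" .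
  qed
qed

section \<open>Measurability on the space of trajectories\<close>

lemma measurable_component:
  assumes "t \<in> {1..T}"
  shows "(\<lambda>\<xi>. \<xi> t $ i) \<in> borel_measurable (traj_space T)"
proof -
  have "(\<lambda>\<xi>. \<xi> t) \<in> measurable (traj_space T) borel"
    unfolding traj_space_def using assms by measurable
  moreover have "(\<lambda>x :: real ^ 'a. x $ i) \<in> borel_measurable borel"
    by (intro borel_measurable_continuous_onI continuous_intros)
  ultimately show ?thesis by (rule measurable_compose)
qed

lemma measurable_lift_comp: "(\<lambda>x. lift_comp p w x m) \<in> borel_measurable borel"
proof -
  have "(\<lambda>x. V_part w x j) \<in> borel_measurable borel" for j
    unfolding V_part_def by measurable
  moreover have "(\<lambda>x. Q_part w x j) \<in> borel_measurable borel" for j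
    unfolding Q_part_def by measurable
  ultimately show ?thesis by (cases "m \<le> p") (simp_all add: lift_comp_def)
qed

lemma measurable_reward: "reward T K p w d r \<in> borel_measurable (traj_space T)"
proof -
  have "full_dot T p w (d k) \<in> borel_measurable (traj_space T)" for k
    unfolding full_dot_def lift_dot_def
    by (intro borel_measurable_sum borel_measurable_times borel_measurable_const
          measurable_compose[OF measurable_component measurable_lift_comp])
  then show ?thesis
    unfolding reward_def by (intro borel_measurable_Max borel_measurable_add) auto
qed

lemma measurable_norm1_dist:
  "(\<lambda>z. norm1_dist T (fst z) (snd z)) \<in>
     borel_measurable (restrict_space (traj_space T) X \<Otimes>\<^sub>M restrict_space (traj_space T) X)"
  unfolding norm1_dist_def
  by (intro borel_measurable_sum borel_measurable_abs borel_measurable_diff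
        measurable_compose[OF measurable_fst measurable_restrict_space1[OF measurable_component]]
        measurable_compose[OF measurable_snd measurable_restrict_space1[OF measurable_component]])

lemma sets_support_box: "support_box T lo hi \<in> sets (traj_space T)"
proof -
  have "support_box T lo hi = {\<xi> \<in> space (traj_space T).
      \<forall>t\<in>{1..T}. \<forall>i\<in>UNIV. \<xi> t $ i \<in> {lo t i..hi t i}}"
    by (auto simp: support_box_def)
  also have "\<dots> \<in> sets (traj_space T)"
  proof (intro sets.sets_Collect_finite_All)
    fix t i assume t: "t \<in> {1..T}"
    have "(\<lambda>\<xi>. \<xi> t $ i) -` {lo t i..hi t i} \<inter> space (traj_space T) \<in> sets (traj_space T)"
      by (rule measurable_sets[OF measurable_component[OF t]]) simp
    then show "{\<xi> \<in> space (traj_space T). \<xi> t $ i \<in> {lo t i..hi t i}} \<in> sets (traj_space T)"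
      by (simp add: vimage_def Int_def conj_commute)
  qed auto
  finally show ?thesis .
qed

lemma singleton_sets_traj_space:
  assumes "\<xi> \<in> space (traj_space T)"
  shows "{\<xi>} \<in> sets (traj_space T)"
proof -
  have "{\<xi>} = PiE {1..T} (\<lambda>t. {\<xi> t})"
    using assms by (intro PiE_singleton[symmetric]) (auto simp: traj_space_def space_PiM PiE_def)
  also have "\<dots> \<in> sets (traj_space T)"
    unfolding traj_space_def by (intro sets_PiM_I_finite) auto
  finally show ?thesis .
qed

section \<open>Duality for a Wasserstein ball around an empirical distribution\<close>

text \<open>
  Lagrangian duality for one constraint \<open>c \<le> \<theta>\<close> over mixtures, without compactness. Above the
  budget the multiplier has to exceed the slopes \<open>(g z - m) / (c z - \<theta>)\<close>, below it has to stay under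
  the slopes \<open>(m - g z) / (\<theta> - c z)\<close>; and a slope of the first kind exceeds one of the second kind
  only if the two-point mixture that exhausts the budget exactly has a reward above \<open>m\<close>.
\<close>

lemma two_point_multiplier:
  fixes c g :: "'z \<Rightarrow> real"
  assumes slater: "z0 \<in> Z" "c z0 < \<theta>"
    and mix: "\<And>q z z'. z \<in> Z \<Longrightarrow> z' \<in> Z \<Longrightarrow> 0 \<le> q \<Longrightarrow> q \<le> 1 \<Longrightarrow>
      q * c z + (1 - q) * c z' \<le> \<theta> \<Longrightarrow> q * g z + (1 - q) * g z' \<le> m"
  obtains \<rho> where "\<rho> \<ge> 0" "\<And>z. z \<in> Z \<Longrightarrow> g z + \<rho> * (\<theta> - c z) \<le> m"
proof -
  have pure: "g z \<le> m" if "z \<in> Z" "c z \<le> \<theta>" for z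
    using mix[of z z 1] that by simp
  have slopes: "(g z' - m) / (c z' - \<theta>) \<le> (m - g z) / (\<theta> - c z)"
    if "z \<in> Z" "c z < \<theta>" "z' \<in> Z" "c z' > \<theta>" for z z'
  proof -
    define q where "q = (c z' - \<theta>) / (c z' - c z)"
    have pos: "c z' - c z > 0" using that by simp
    have q: "0 \<le> q" "q \<le> 1" using that pos by (auto simp: q_def divide_simps)
    have q': "q * (c z' - c z) = c z' - \<theta>" "(1 - q) * (c z' - c z) = \<theta> - c z"
      using pos by (auto simp: q_def field_simps)
    have "q * c z + (1 - q) * c z' = \<theta>" using q' by (simp add: algebra_simps)
    then have "q * g z + (1 - q) * g z' \<le> m" using mix q that by simp
    then have "(c z' - c z) * (q * g z + (1 - q) * g z') \<le> (c z' - c z) * m"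
      using pos by simp
    also have "(c z' - c z) * (q * g z + (1 - q) * g z')
      = (q * (c z' - c z)) * g z + ((1 - q) * (c z' - c z)) * g z'"
      by (simp add: algebra_simps)
    finally have "(c z' - \<theta>) * g z + (\<theta> - c z) * g z' \<le> (c z' - c z) * m" unfolding q' .
    then have "(g z' - m) * (\<theta> - c z) \<le> (m - g z) * (c z' - \<theta>)" by (simp add: algebra_simps)
    then show ?thesis using that by (simp add: divide_simps)
  qed
  define A where "A = insert 0 ((\<lambda>z. (g z - m) / (c z - \<theta>)) ` {z \<in> Z. c z > \<theta>})"
  define \<rho> where "\<rho> = Sup A"
  have upper: "x \<le> (m - g z) / (\<theta> - c z)" if "z \<in> Z" "c z < \<theta>" "x \<in> A" for x z
    using that slopes pure[of z] by (auto simp: A_def)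
  have bdd: "bdd_above A" using upper[OF slater] by (rule bdd_aboveI)
  have \<rho>_ge: "x \<le> \<rho>" if "x \<in> A" for x unfolding \<rho>_def by (rule cSup_upper[OF that bdd])
  show ?thesis
  proof (rule that)
    show "\<rho> \<ge> 0" by (rule \<rho>_ge) (simp add: A_def)
    fix z assume z: "z \<in> Z"
    consider "c z < \<theta>" | "c z = \<theta>" | "c z > \<theta>" by linarith
    then show "g z + \<rho> * (\<theta> - c z) \<le> m"
    proof cases
      case 1
      have "\<rho> \<le> (m - g z) / (\<theta> - c z)"
        unfolding \<rho>_def by (rule cSup_least) (use upper[OF z 1] in \<open>auto simp: A_def\<close>)
      then show ?thesis using 1 by (simp add: field_simps)
    next
      case 2
      then show ?thesis using pure[OF z] by simp
    next
      case 3
      then have "(g z - m) / (c z - \<theta>) \<le> \<rho>" using z by (intro \<rho>_ge) (auto simp: A_def)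
      then show ?thesis using 3 by (simp add: field_simps)
    qed
  qed
qed

lemma norm1_dist_nonneg: "norm1_dist T \<xi> y \<ge> 0"
  unfolding norm1_dist_def by (intro sum_nonneg) auto

text \<open>
  The definition of \<open>empirical\<close> prescribes values by \<open>measure_of\<close>; they are attained because they are
  those of the law of a uniformly drawn sample.
\<close>

lemma empirical_eq_distr:
  assumes N: "N \<ge> 1" and xs: "\<And>s. xs s \<in> space S"
  shows "empirical S N xs = distr (measure_pmf (pmf_of_set {1..N})) S xs" (is "_ = ?M")
proof -
  have meas: "xs \<in> measurable (measure_pmf (pmf_of_set {1..N})) S" using xs by auto
  have "ennreal (1 / real N) * (\<Sum>s=1..N. emeasure (return S (xs s)) E) = emeasure ?M E"
    if E: "E \<in> sets S" for E
  proof -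
    have "emeasure ?M E = (\<integral>\<^sup>+ y. indicator E y \<partial>?M)" using E by simp
    also have "\<dots> = (\<integral>\<^sup>+ s. indicator E (xs s) \<partial>measure_pmf (pmf_of_set {1..N}))"
      using E by (intro nn_integral_distr meas) auto
    also have "\<dots> = (\<Sum>s=1..N. indicator E (xs s)) / ennreal (real N)"
      using N by (subst nn_integral_pmf_of_set) (auto simp: ennreal_of_nat_eq_real_of_nat)
    also have "\<dots> = ennreal (1 / real N) * (\<Sum>s=1..N. emeasure (return S (xs s)) E)"
      using E N by (simp add: divide_ennreal_def inverse_ennreal mult.commute inverse_eq_divide)
    finally show ?thesis ..
  qed
  then have "empirical S N xs = measure_of (space S) (sets S) (emeasure ?M)"
    unfolding empirical_def using sets.space_closed by (intro measure_of_eq) (auto simp: sets.sigma_sets_eq)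
  also have "\<dots> = ?M" using measure_of_of_measure[of ?M] by simp
  finally show ?thesis .
qed

text \<open>
  Weak duality. Along a coupling, \<open>f \<xi>\<close> is at most \<open>\<rho>\<close> times the transported distance plus a
  function of the target sample. Samples may coincide, which is why that function takes the least
  \<open>\<eta> s\<close> over all \<open>s\<close> with this sample.
\<close>

lemma integral_le_on_wasserstein_ball:
  fixes S :: "('n::finite) trajectory measure"
  assumes f: "f \<in> borel_measurable S" "\<And>\<xi>. \<xi> \<in> space S \<Longrightarrow> \<bar>f \<xi>\<bar> \<le> b"
    and cost: "(\<lambda>z. norm1_dist T (fst z) (snd z)) \<in> borel_measurable (S \<Otimes>\<^sub>M S)"
    and N: "N \<ge> 1" and xs: "\<And>s. xs s \<in> space S" "\<And>s. {xs s} \<in> sets S"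
    and \<rho>: "\<rho> \<ge> 0" and \<theta>: "\<theta> \<ge> 0"
    and ball: "wasserstein T S P (empirical S N xs) \<le> ennreal \<theta>"
    and bound: "\<And>\<xi> s. \<xi> \<in> space S \<Longrightarrow> s \<in> {1..N} \<Longrightarrow> f \<xi> \<le> \<eta> s + \<rho> * norm1_dist T \<xi> (xs s)"
  shows "(\<integral>\<xi>. f \<xi> \<partial>P) \<le> \<rho> * \<theta> + 1 / real N * (\<Sum>s=1..N. \<eta> s)"
proof -
  define M where "M = measure_pmf (pmf_of_set {1..N})"
  have emp: "empirical S N xs = distr M S xs"
    using empirical_eq_distr[OF N xs(1)] by (simp add: M_def)
  have xs_meas: "xs \<in> measurable M S" using xs by (auto simp: M_def)
  define m where "m y = Min (\<eta> ` {s \<in> {1..N}. xs s = y})" for y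
  define h where "h y = (\<Sum>y'\<in>xs ` {1..N}. m y' * indicator {y'} y)" for y
  have h_xs: "h y = m y" if "y \<in> xs ` {1..N}" for y
  proof -
    have "h y = (\<Sum>y'\<in>xs ` {1..N}. if y' = y then m y else 0)"
      unfolding h_def by (intro sum.cong) (auto simp: indicator_def)
    then show ?thesis using that by simp
  qed
  have h_le: "h (xs s) \<le> \<eta> s" if "s \<in> {1..N}" for s
    using that h_xs[of "xs s"] by (auto simp: m_def)
  have f_le: "f \<xi> \<le> h y + \<rho> * norm1_dist T \<xi> y" if "\<xi> \<in> space S" "y \<in> xs ` {1..N}" for \<xi> y
  proof -
    have "m y \<in> \<eta> ` {s \<in> {1..N}. xs s = y}" unfolding m_def using that by (intro Min_in) auto
    then show ?thesis using bound[OF that(1)] h_xs[OF that(2)] by auto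
  qed
  have h_meas [measurable]: "h \<in> borel_measurable S"
    unfolding h_def using xs by (intro borel_measurable_sum borel_measurable_times) auto
  have "(\<integral>\<xi>. f \<xi> \<partial>P) \<le> \<rho> * (\<theta> + e) + 1 / real N * (\<Sum>s=1..N. \<eta> s)" if e: "e > 0" for e
  proof -
    have "wasserstein T S P (empirical S N xs) < ennreal (\<theta> + e)"
      using ball e \<theta> by (auto intro: le_less_trans simp: ennreal_less_iff)
    then obtain \<kappa> where \<kappa>: "\<kappa> \<in> couplings S P (empirical S N xs)"
      "(\<integral>\<^sup>+ z. ennreal (norm1_dist T (fst z) (snd z)) \<partial>\<kappa>) < ennreal (\<theta> + e)"
      unfolding wasserstein_def INF_less_iff by blast
    interpret \<kappa>: prob_space \<kappa> using \<kappa>(1) by (simp add: couplings_def)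
    have sets_\<kappa>: "sets \<kappa> = sets (S \<Otimes>\<^sub>M S)" and margins: "distr \<kappa> S fst = P" "distr \<kappa> S snd = distr M S xs"
      using \<kappa>(1) by (simp_all add: couplings_def emp)
    have space_\<kappa>: "space \<kappa> = space S \<times> space S"
      using sets_eq_imp_space_eq[OF sets_\<kappa>] by (simp add: space_pair_measure)
    have meas [measurable]: "fst \<in> measurable \<kappa> S" "snd \<in> measurable \<kappa> S"
      using measurable_cong_sets[OF sets_\<kappa> refl] by auto
    have cost' [measurable]: "(\<lambda>z. norm1_dist T (fst z) (snd z)) \<in> borel_measurable \<kappa>"
      using cost measurable_cong_sets[OF sets_\<kappa> refl] by auto
    have cost_int: "integrable \<kappa> (\<lambda>z. norm1_dist T (fst z) (snd z))"
      using \<kappa>(2) by (intro integrableI_nonneg) (auto simp: norm1_dist_nonneg intro: less_trans)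
    have cost_le: "(\<integral>z. norm1_dist T (fst z) (snd z) \<partial>\<kappa>) \<le> \<theta> + e"
    proof -
      have "ennreal (\<integral>z. norm1_dist T (fst z) (snd z) \<partial>\<kappa>) < ennreal (\<theta> + e)"
        using \<kappa>(2) nn_integral_eq_integral[OF cost_int] by (simp add: norm1_dist_nonneg)
      moreover have "(\<integral>z. norm1_dist T (fst z) (snd z) \<partial>\<kappa>) \<ge> 0"
        by (intro Bochner_Integration.integral_nonneg norm1_dist_nonneg)
      ultimately show ?thesis by (simp add: ennreal_less_iff del: ennreal_plus)
    qed
    have f_int: "integrable \<kappa> (\<lambda>z. f (fst z))"
      using f by (intro \<kappa>.integrable_const_bound[where B = b])
        (auto simp: space_\<kappa> intro!: AE_I2 measurable_compose[OF meas(1) f(1)])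
    have h_int: "integrable \<kappa> (\<lambda>z. h (snd z))"
    proof (rule \<kappa>.integrable_const_bound)
      show "AE z in \<kappa>. norm (h (snd z)) \<le> (\<Sum>y\<in>xs ` {1..N}. \<bar>m y\<bar>)"
        unfolding h_def real_norm_def
        by (intro AE_I2 order_trans[OF sum_abs] sum_mono) (auto simp: indicator_def)
    qed (rule measurable_compose[OF meas(2) h_meas])
    have supp: "AE z in \<kappa>. snd z \<in> xs ` {1..N}"
    proof -
      have set: "{y \<in> space S. y \<in> xs ` {1..N}} \<in> sets S"
      proof -
        have "{y \<in> space S. y \<in> xs ` {1..N}} = (\<Union>s\<in>{1..N}. {xs s})" using xs by auto
        also have "\<dots> \<in> sets S" using xs by (intro sets.finite_UN) auto
        finally show ?thesis .
      qed
      have "AE s in M. xs s \<in> xs ` {1..N}"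
        unfolding M_def AE_measure_pmf_iff using N by auto
      then have "AE y in distr \<kappa> S snd. y \<in> xs ` {1..N}"
        unfolding margins using set by (subst AE_distr_iff[OF xs_meas]) auto
      then show ?thesis using set by (subst (asm) AE_distr_iff[OF meas(2)]) auto
    qed
    have "(\<integral>\<xi>. f \<xi> \<partial>P) = (\<integral>z. f (fst z) \<partial>\<kappa>)"
      unfolding margins(1)[symmetric] by (intro integral_distr meas f)
    also have "\<dots> \<le> (\<integral>z. h (snd z) + \<rho> * norm1_dist T (fst z) (snd z) \<partial>\<kappa>)"
    proof (intro integral_mono_AE f_int Bochner_Integration.integrable_add h_int integrable_mult_right cost_int)
      show "AE z in \<kappa>. f (fst z) \<le> h (snd z) + \<rho> * norm1_dist T (fst z) (snd z)"
        using supp AE_space by eventually_elim (auto simp: space_\<kappa> intro!: f_le)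
    qed
    also have "\<dots> = (\<integral>z. h (snd z) \<partial>\<kappa>) + \<rho> * (\<integral>z. norm1_dist T (fst z) (snd z) \<partial>\<kappa>)"
      using h_int cost_int by simp
    also have "(\<integral>z. h (snd z) \<partial>\<kappa>) = (\<integral>y. h y \<partial>distr M S xs)"
      unfolding margins(2)[symmetric] by (intro integral_distr[symmetric] meas h_meas)
    also have "\<dots> = (\<integral>s. h (xs s) \<partial>M)" by (intro integral_distr xs_meas h_meas)
    also have "\<dots> = (\<Sum>s=1..N. h (xs s)) / real N"
      using N by (simp add: M_def integral_pmf_of_set)
    also have "(\<Sum>s=1..N. h (xs s)) / real N \<le> (\<Sum>s=1..N. \<eta> s) / real N"
      using h_le by (intro divide_right_mono sum_mono) auto
    also have "\<rho> * (\<integral>z. norm1_dist T (fst z) (snd z) \<partial>\<kappa>) \<le> \<rho> * (\<theta> + e)"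
      using cost_le \<rho> by (rule mult_left_mono)
    finally show ?thesis by simp
  qed
  note * = this
  show ?thesis
  proof (rule field_le_epsilon)
    fix e :: real assume e: "e > 0"
    have "(\<integral>\<xi>. f \<xi> \<partial>P) \<le> \<rho> * (\<theta> + e / (\<rho> + 1)) + 1 / real N * (\<Sum>s=1..N. \<eta> s)"
      using e \<rho> by (intro *) auto
    moreover have "\<rho> * (e / (\<rho> + 1)) \<le> e" using e \<rho> by (simp add: field_simps)
    ultimately show "(\<integral>\<xi>. f \<xi> \<partial>P) \<le> \<rho> * \<theta> + 1 / real N * (\<Sum>s=1..N. \<eta> s) + e"
      by (simp add: algebra_simps)
  qed
qed

lemma integral_uniform_bernoulli:
  fixes h :: "nat \<times> bool \<Rightarrow> real"
  assumes "N \<ge> 1" "0 \<le> q" "q \<le> 1"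
  shows "(\<integral>a. h a \<partial>measure_pmf (pair_pmf (pmf_of_set {1..N}) (bernoulli_pmf q)))
    = q * (1 / real N * (\<Sum>s=1..N. h (s, True))) + (1 - q) * (1 / real N * (\<Sum>s=1..N. h (s, False)))"
proof -
  have "(\<integral>a. h a \<partial>measure_pmf (pair_pmf (pmf_of_set {1..N}) (bernoulli_pmf q)))
    = (\<Sum>a\<in>{1..N} \<times> UNIV. h a * pmf (pair_pmf (pmf_of_set {1..N}) (bernoulli_pmf q)) a)"
    using assms by (intro integral_measure_pmf_real) auto
  also have "\<dots> = (\<Sum>s=1..N. \<Sum>b\<in>UNIV. h (s, b) * (1 / real N * pmf (bernoulli_pmf q) b))"
    using assms unfolding sum.cartesian_product' by (intro sum.cong refl) (simp add: pmf_pair)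
  also have "\<dots> = (\<Sum>s=1..N. q * (1 / real N * h (s, True)) + (1 - q) * (1 / real N * h (s, False)))"
    using assms by (simp add: UNIV_bool algebra_simps)
  finally show ?thesis by (simp add: sum.distrib sum_distrib_left)
qed

text \<open>
  Strong duality. A transport plan that moves every sample to one place is a tuple of points. The
  mixtures of two such plans that keep to the budget already attain, up to \<open>e\<close>, the dual value: by
  \<open>two_point_multiplier\<close> there is a \<open>\<rho>\<close> for which the supremum over these mixtures bounds
  \<open>g z + \<rho> * (\<theta> - c z)\<close> for every tuple \<open>z\<close> with average reward \<open>g z\<close> and average distance
  \<open>c z\<close>; and the largest such value is a sum of one supremum per sample, the least possible \<open>\<eta> s\<close>.
\<close>

lemma nearly_optimal_mixture:
  fixes S :: "('n::finite) trajectory measure"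
  assumes f: "f \<in> borel_measurable S" "\<And>\<xi>. \<xi> \<in> space S \<Longrightarrow> \<bar>f \<xi>\<bar> \<le> b"
    and cost: "(\<lambda>z. norm1_dist T (fst z) (snd z)) \<in> borel_measurable (S \<Otimes>\<^sub>M S)"
    and N: "N \<ge> 1" and xs: "\<And>s. xs s \<in> space S"
    and \<theta>: "\<theta> > 0" and e: "e > 0"
  obtains \<rho> \<eta> \<mu> and z :: "nat \<times> bool \<Rightarrow> 'n trajectory" where "\<rho> \<ge> 0"
    "\<And>\<xi> s. \<xi> \<in> space S \<Longrightarrow> f \<xi> \<le> \<eta> s + \<rho> * norm1_dist T \<xi> (xs s)"
    "\<And>a. z a \<in> space S"
    "wasserstein T S (distr (measure_pmf \<mu>) S z) (empirical S N xs) \<le> ennreal \<theta>"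
    "\<rho> * \<theta> + 1 / real N * (\<Sum>s=1..N. \<eta> s) \<le> (\<integral>\<xi>. f \<xi> \<partial>distr (measure_pmf \<mu>) S z) + e"
proof -
  define c :: "(nat \<Rightarrow> 'n trajectory) \<Rightarrow> real"
    where "c z = 1 / real N * (\<Sum>s=1..N. norm1_dist T (z s) (xs s))" for z
  define g :: "(nat \<Rightarrow> 'n trajectory) \<Rightarrow> real"
    where "g z = 1 / real N * (\<Sum>s=1..N. f (z s))" for z
  define Z :: "(nat \<Rightarrow> 'n trajectory) set" where "Z = {z. \<forall>s. z s \<in> space S}"
  define R where "R = {q * g z + (1 - q) * g z' | q z z'. z \<in> Z \<and> z' \<in> Z \<and> 0 \<le> q \<and> q \<le> 1 \<and>
    q * c z + (1 - q) * c z' \<le> \<theta>}"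
  have xs_Z: "xs \<in> Z" "c xs = 0" using xs by (auto simp: Z_def c_def norm1_dist_def)
  have g_le: "g z \<le> b" if "z \<in> Z" for z
  proof -
    have "(\<Sum>s=1..N. f (z s)) \<le> (\<Sum>s=1..N. b)"
      by (rule sum_mono, rule abs_le_D1, rule f(2)) (use that in \<open>simp add: Z_def\<close>)
    then show ?thesis using N by (simp add: g_def field_simps)
  qed
  have "x \<le> b" if "x \<in> R" for x
    using that by (auto simp: R_def intro!: convex_bound_le g_le)
  then have bdd: "bdd_above R" by (rule bdd_aboveI)
  have R_ne: "R \<noteq> {}" unfolding R_def using xs_Z \<theta> by force
  obtain \<rho> where \<rho>: "\<rho> \<ge> 0" "\<And>z. z \<in> Z \<Longrightarrow> g z + \<rho> * (\<theta> - c z) \<le> Sup R"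
  proof (rule two_point_multiplier[of xs Z c \<theta> g "Sup R"])
    fix q z z' assume "z \<in> Z" "z' \<in> Z" "0 \<le> q" "q \<le> 1" "q * c z + (1 - q) * c z' \<le> \<theta>"
    then show "q * g z + (1 - q) * g z' \<le> Sup R"
      by (intro cSup_upper bdd) (auto simp: R_def)
  qed (use xs_Z \<theta> in auto)
  define \<eta> where "\<eta> s = (SUP \<xi>\<in>space S. f \<xi> - \<rho> * norm1_dist T \<xi> (xs s))" for s
  have \<eta>: "f \<xi> \<le> \<eta> s + \<rho> * norm1_dist T \<xi> (xs s)" if "\<xi> \<in> space S" for \<xi> s
  proof -
    have "f \<xi>' - \<rho> * norm1_dist T \<xi>' (xs s) \<le> b" if "\<xi>' \<in> space S" for \<xi>'
      using f(2)[OF that] mult_nonneg_nonneg[OF \<rho>(1) norm1_dist_nonneg[of T \<xi>' "xs s"]] by linarith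
    then have "bdd_above ((\<lambda>\<xi>. f \<xi> - \<rho> * norm1_dist T \<xi> (xs s)) ` space S)"
      by (rule bdd_aboveI2)
    then have "f \<xi> - \<rho> * norm1_dist T \<xi> (xs s) \<le> \<eta> s"
      unfolding \<eta>_def using that by (intro cSUP_upper)
    then show ?thesis by simp
  qed
  have "(\<Sum>s=1..N. \<eta> s) \<le> real N * (Sup R - \<rho> * \<theta>)"
    unfolding \<eta>_def
  proof (rule sum_SUP_le)
    fix x assume x: "\<And>s. s \<in> {1..N} \<Longrightarrow> x s \<in> space S"
    define z where "z s = (if s \<in> {1..N} then x s else xs s)" for s
    have "z \<in> Z" using x xs by (auto simp: Z_def z_def)
    then have "g z - \<rho> * c z \<le> Sup R - \<rho> * \<theta>" using \<rho>(2) by (simp add: algebra_simps)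
    then have "real N * (g z - \<rho> * c z) \<le> real N * (Sup R - \<rho> * \<theta>)" by (intro mult_left_mono) auto
    also have "real N * (g z - \<rho> * c z) = (\<Sum>s=1..N. f (z s) - \<rho> * norm1_dist T (z s) (xs s))"
      using N by (simp add: g_def c_def sum_subtractf sum_distrib_left right_diff_distrib)
    also have "\<dots> = (\<Sum>s=1..N. f (x s) - \<rho> * norm1_dist T (x s) (xs s))"
      by (intro sum.cong) (auto simp: z_def)
    finally show "(\<Sum>s=1..N. f (x s) - \<rho> * norm1_dist T (x s) (xs s)) \<le> real N * (Sup R - \<rho> * \<theta>)" .
  qed (use xs in auto)
  then have dual: "\<rho> * \<theta> + 1 / real N * (\<Sum>s=1..N. \<eta> s) \<le> Sup R"
    using N by (simp add: field_simps)
  obtain x where "x \<in> R" "Sup R - e < x"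
    using less_cSup_iff[OF R_ne bdd, of "Sup R - e"] e by auto
  then obtain q z1 z2 where z12: "z1 \<in> Z" "z2 \<in> Z" and q: "0 \<le> q" "q \<le> 1"
    and budget: "q * c z1 + (1 - q) * c z2 \<le> \<theta>" and gain: "Sup R - e < q * g z1 + (1 - q) * g z2"
    by (auto simp: R_def)
  define \<mu> where "\<mu> = pair_pmf (pmf_of_set {1..N}) (bernoulli_pmf q)"
  define z :: "nat \<times> bool \<Rightarrow> 'n trajectory" where "z = (\<lambda>(s, b). if b then z1 s else z2 s)"
  have z_S: "z a \<in> space S" for a using z12 by (auto simp: z_def Z_def split: prod.split)
  define \<kappa> where "\<kappa> = distr (measure_pmf \<mu>) (S \<Otimes>\<^sub>M S) (\<lambda>a. (z a, xs (fst a)))"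
  have \<kappa>_meas: "(\<lambda>a. (z a, xs (fst a))) \<in> measurable (measure_pmf \<mu>) (S \<Otimes>\<^sub>M S)"
    using z_S xs by (auto simp: space_pair_measure)
  have "\<kappa> \<in> couplings S (distr (measure_pmf \<mu>) S z) (empirical S N xs)"
  proof -
    have "distr \<kappa> S fst = distr (measure_pmf \<mu>) S z"
      unfolding \<kappa>_def by (subst distr_distr[OF _ \<kappa>_meas]) (auto simp: comp_def)
    moreover have "distr \<kappa> S snd = empirical S N xs"
    proof -
      have "distr \<kappa> S snd = distr (measure_pmf \<mu>) S (\<lambda>a. xs (fst a))"
        unfolding \<kappa>_def by (subst distr_distr[OF _ \<kappa>_meas]) (auto simp: comp_def)
      also have "\<dots> = distr (measure_pmf (map_pmf fst \<mu>)) S xs"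
        unfolding map_pmf_rep_eq using xs by (subst distr_distr) (auto simp: comp_def)
      also have "map_pmf fst \<mu> = pmf_of_set {1..N}" by (simp add: \<mu>_def map_fst_pair_pmf)
      finally show ?thesis using empirical_eq_distr[OF N xs] by simp
    qed
    moreover have "prob_space \<kappa>"
      unfolding \<kappa>_def by (intro measure_pmf.prob_space_distr \<kappa>_meas)
    ultimately show ?thesis by (simp add: couplings_def \<kappa>_def)
  qed
  then have "wasserstein T S (distr (measure_pmf \<mu>) S z) (empirical S N xs)
      \<le> (\<integral>\<^sup>+ y. ennreal (norm1_dist T (fst y) (snd y)) \<partial>\<kappa>)"
    unfolding wasserstein_def by (rule INF_lower)
  also have "\<dots> = (\<integral>\<^sup>+ a. ennreal (norm1_dist T (z a) (xs (fst a))) \<partial>measure_pmf \<mu>)"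
    unfolding \<kappa>_def using cost by (subst nn_integral_distr[OF \<kappa>_meas]) auto
  also have "\<dots> = ennreal (\<integral>a. norm1_dist T (z a) (xs (fst a)) \<partial>measure_pmf \<mu>)"
  proof (intro nn_integral_eq_integral integrable_measure_pmf_finite)
    show "finite (set_pmf \<mu>)" using N by (auto simp: \<mu>_def intro: finite_subset[OF subset_UNIV])
  qed (simp add: norm1_dist_nonneg)
  also have "(\<integral>a. norm1_dist T (z a) (xs (fst a)) \<partial>measure_pmf \<mu>) = q * c z1 + (1 - q) * c z2"
    unfolding \<mu>_def integral_uniform_bernoulli[OF N q] by (simp add: z_def c_def)
  also have "ennreal (q * c z1 + (1 - q) * c z2) \<le> ennreal \<theta>" using budget by (rule ennreal_leI)
  finally have ball: "wasserstein T S (distr (measure_pmf \<mu>) S z) (empirical S N xs) \<le> ennreal \<theta>" .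
  have "(\<integral>\<xi>. f \<xi> \<partial>distr (measure_pmf \<mu>) S z) = (\<integral>a. f (z a) \<partial>measure_pmf \<mu>)"
    using z_S f(1) by (intro integral_distr) auto
  also have "\<dots> = q * g z1 + (1 - q) * g z2"
    unfolding \<mu>_def integral_uniform_bernoulli[OF N q] by (simp add: z_def g_def)
  finally show ?thesis
    using that[OF \<rho>(1) \<eta> z_S ball] dual gain by simp
qed

section \<open>Disintegration over the scenarios\<close>

text \<open>
  The factor \<open>q\<close> cancels the normalisation of the conditional measure. The reward is bounded on the
  support only, so the support condition is what makes it integrable; for \<open>q = 0\<close>, where there is no
  conditional law, both sides vanish.
\<close>

lemma integral_scenario:
  fixes Q :: "(('n::finite) trajectory \<times> nat) measure"
  assumes "prob_space Q" and sets_Q: "sets Q = sets (traj_space T \<Otimes>\<^sub>M count_space {1..L})"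
    and prob: "\<P>(\<omega> in Q. snd \<omega> = l) = q"
    and supp: "q > 0 \<Longrightarrow> \<P>(\<omega> in Q. fst \<omega> \<in> X \<bar> snd \<omega> = l) = 1"
    and X: "X \<in> sets (traj_space T)"
    and f: "f \<in> borel_measurable (traj_space T)" "\<And>\<xi>. \<xi> \<in> X \<Longrightarrow> \<bar>f \<xi>\<bar> \<le> b"
  shows "integrable Q (\<lambda>\<omega>. indicator {l} (snd \<omega>) * f (fst \<omega>))"
    and "(\<integral>\<omega>. indicator {l} (snd \<omega>) * f (fst \<omega>) \<partial>Q)
      = q * (\<integral>\<xi>. f \<xi> \<partial>restrict_space (cond_law T Q l) X)"
proof -
  interpret prob_space Q by fact
  define B where "B = {\<omega> \<in> space Q. snd \<omega> = l}"
  have fst_meas [measurable]: "fst \<in> measurable Q (traj_space T)"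
    using measurable_cong_sets[OF sets_Q refl] by auto
  have snd_meas: "snd \<in> measurable Q (count_space {1..L})"
    using measurable_cong_sets[OF sets_Q refl] by auto
  have B: "B \<in> sets Q"
  proof -
    have "B = snd -` ({l} \<inter> {1..L}) \<inter> space Q"
      using measurable_space[OF snd_meas] by (auto simp: B_def)
    then show ?thesis using measurable_sets[OF snd_meas, of "{l} \<inter> {1..L}"] by simp
  qed
  have prob_B: "prob B = q" using prob by (simp add: B_def)
  have X_B: "{\<omega> \<in> space Q. fst \<omega> \<in> X} \<in> sets Q"
    using measurable_sets[OF fst_meas X] by (simp add: vimage_def Int_def conj_commute)
  have supp': "AE \<omega> in Q. snd \<omega> = l \<longrightarrow> fst \<omega> \<in> X"
  proof -
    have "prob ({\<omega> \<in> space Q. fst \<omega> \<in> X} \<inter> B) = prob B"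
    proof (cases "q > 0")
      case True
      have "{\<omega> \<in> space Q. fst \<omega> \<in> X} \<inter> B = {\<omega> \<in> space Q. fst \<omega> \<in> X \<and> snd \<omega> = l}"
        by (auto simp: B_def)
      then show ?thesis
        using supp[OF True] True prob_B prob by (simp add: cond_prob_def)
    next
      case False
      then have "q = 0" using prob_B measure_nonneg[of Q B] by simp
      then show ?thesis
        using prob_B finite_measure_mono[of "{\<omega> \<in> space Q. fst \<omega> \<in> X} \<inter> B" B] B
        by (simp add: measure_le_0_iff)
    qed
    then have "prob (B - ({\<omega> \<in> space Q. fst \<omega> \<in> X} \<inter> B)) = 0"
      using finite_measure_Diff[OF B, of "{\<omega> \<in> space Q. fst \<omega> \<in> X} \<inter> B"] X_B B by auto
    moreover have "B - ({\<omega> \<in> space Q. fst \<omega> \<in> X} \<inter> B) \<in> sets Q" using B X_B by auto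
    ultimately show ?thesis
      by (intro AE_I[where N = "B - ({\<omega> \<in> space Q. fst \<omega> \<in> X} \<inter> B)"])
         (auto simp: B_def emeasure_eq_measure)
  qed
  have ind_B: "indicator {l} (snd \<omega>) = (indicator B \<omega> :: real)" if "\<omega> \<in> space Q" for \<omega>
    using that by (simp add: B_def indicator_def)
  have f_fst: "(\<lambda>\<omega>. f (fst \<omega>)) \<in> borel_measurable Q"
    by (rule measurable_compose[OF fst_meas f(1)])
  have meas: "(\<lambda>\<omega>. indicator {l} (snd \<omega>) * f (fst \<omega>)) \<in> borel_measurable Q"
  proof -
    have "(\<lambda>\<omega>. indicator B \<omega> * f (fst \<omega>)) \<in> borel_measurable Q"
      using B f_fst by (intro borel_measurable_times) auto
    then show ?thesis by (rule measurable_cong[THEN iffD1, rotated]) (simp add: ind_B)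
  qed
  have "AE \<omega> in Q. norm (indicator {l} (snd \<omega>) * f (fst \<omega>)) \<le> \<bar>b\<bar>"
    using supp'
  proof eventually_elim
    case (elim \<omega>)
    show ?case
    proof (cases "snd \<omega> = l")
      case True
      then have "\<bar>f (fst \<omega>)\<bar> \<le> b" using elim f(2) by simp
      then show ?thesis using True by simp
    qed simp
  qed
  then show "integrable Q (\<lambda>\<omega>. indicator {l} (snd \<omega>) * f (fst \<omega>))"
    using meas by (rule integrable_const_bound)
  show "(\<integral>\<omega>. indicator {l} (snd \<omega>) * f (fst \<omega>) \<partial>Q)
      = q * (\<integral>\<xi>. f \<xi> \<partial>restrict_space (cond_law T Q l) X)"
  proof (cases "q > 0")
    case True
    have "1 / ennreal q = ennreal (1 / q)" using divide_ennreal[of 1 q] True by simp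
    then have unif: "uniform_measure Q B = density Q (\<lambda>\<omega>. ennreal (indicator B \<omega> / q))"
      unfolding uniform_measure_def using True
      by (intro density_cong)
        (use B in \<open>auto simp: emeasure_eq_measure prob_B indicator_def\<close>)
    have "(\<integral>\<xi>. f \<xi> \<partial>restrict_space (cond_law T Q l) X)
        = (\<integral>\<xi>. indicator X \<xi> *\<^sub>R f \<xi> \<partial>cond_law T Q l)"
      using X by (intro integral_restrict_space) (auto simp: cond_law_def)
    also have "\<dots> = (\<integral>\<omega>. indicator X (fst \<omega>) *\<^sub>R f (fst \<omega>) \<partial>uniform_measure Q B)"
      unfolding cond_law_def B_def[symmetric]
    proof (rule integral_distr)
      show "fst \<in> measurable (uniform_measure Q B) (traj_space T)"
        using fst_meas by (simp add: measurable_def)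
      show "(\<lambda>\<xi>. indicator X \<xi> *\<^sub>R f \<xi>) \<in> borel_measurable (traj_space T)"
        using X f by (intro borel_measurable_scaleR) auto
    qed
    also have "\<dots> = (\<integral>\<omega>. (indicator B \<omega> / q) *\<^sub>R (indicator X (fst \<omega>) *\<^sub>R f (fst \<omega>)) \<partial>Q)"
      unfolding unif using True B f_fst X
      by (intro integral_density borel_measurable_scaleR measurable_compose[OF fst_meas] f(1)) auto
    also have "\<dots> = (\<integral>\<omega>. indicator {l} (snd \<omega>) * f (fst \<omega>) / q \<partial>Q)"
    proof (rule integral_cong_AE)
      show "(\<lambda>\<omega>. (indicator B \<omega> / q) *\<^sub>R (indicator X (fst \<omega>) *\<^sub>R f (fst \<omega>))) \<in> borel_measurable Q"
        using B f_fst X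
        by (intro borel_measurable_scaleR borel_measurable_divide measurable_compose[OF fst_meas, of "indicator X"]) auto
      show "AE \<omega> in Q. (indicator B \<omega> / q) *\<^sub>R (indicator X (fst \<omega>) *\<^sub>R f (fst \<omega>))
          = indicator {l} (snd \<omega>) * f (fst \<omega>) / q"
        using supp' AE_space by eventually_elim (auto simp: B_def indicator_def)
    qed (use meas in simp)
    finally show ?thesis using True by simp
  next
    case False
    then have "q = 0" using prob_B measure_nonneg[of Q B] by simp
    then have "AE \<omega> in Q. \<not> snd \<omega> = l"
      using prob_B B by (intro AE_I[where N = B]) (auto simp: B_def emeasure_eq_measure)
    then have "(\<integral>\<omega>. indicator {l} (snd \<omega>) * f (fst \<omega>) \<partial>Q) = (\<integral>\<omega>. 0 \<partial>Q)"
      using meas by (intro integral_cong_AE) auto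
    then show ?thesis using \<open>q = 0\<close> by simp
  qed
qed

text \<open>
  Conversely, conditional laws can be prescribed. Discrete laws suffice here, so that all the
  randomness can be carried by one probability mass function on pairs of scenario and atom.
\<close>

lemma exists_joint_law:
  fixes prb :: "nat \<Rightarrow> real" and \<mu> :: "nat \<Rightarrow> 'a pmf" and z :: "nat \<Rightarrow> 'a \<Rightarrow> ('n::finite) trajectory"
  assumes prb: "\<And>l. l \<in> {1..L} \<Longrightarrow> prb l \<ge> 0" "(\<Sum>l=1..L. prb l) = 1"
    and z: "\<And>l a. l \<in> {1..L} \<Longrightarrow> z l a \<in> space (traj_space T)"
  obtains Q where "prob_space Q" "sets Q = sets (traj_space T \<Otimes>\<^sub>M count_space {1..L})"
    "\<And>l. l \<in> {1..L} \<Longrightarrow> \<P>(\<omega> in Q. snd \<omega> = l) = prb l"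
    "\<And>l. l \<in> {1..L} \<Longrightarrow> prb l > 0 \<Longrightarrow>
       cond_law T Q l = distr (measure_pmf (\<mu> l)) (traj_space T) (z l)"
proof -
  let ?S = "traj_space T \<Otimes>\<^sub>M count_space {1..L}"
  have L: "1 \<in> {1..L}" using prb(2) by (cases L) auto
  define pl where "pl = embed_pmf (\<lambda>l. if l \<in> {1..L} then prb l else 0)"
  have total: "(\<integral>\<^sup>+ l. ennreal (if l \<in> {1..L} then prb l else 0) \<partial>count_space UNIV) = 1"
  proof -
    have "(\<integral>\<^sup>+ l. ennreal (if l \<in> {1..L} then prb l else 0) \<partial>count_space UNIV)
      = (\<Sum>l=1..L. ennreal (if l \<in> {1..L} then prb l else 0))"
      by (intro nn_integral_count_space') auto
    also have "\<dots> = ennreal (\<Sum>l=1..L. prb l)"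
      using prb(1) by (subst sum_ennreal[symmetric]) (auto intro!: sum.cong)
    finally show ?thesis using prb(2) by simp
  qed
  have pmf_pl: "pmf pl l = (if l \<in> {1..L} then prb l else 0)" for l
    unfolding pl_def using total prb(1) by (intro pmf_embed_pmf) auto
  define R where "R = bind_pmf pl (\<lambda>l. map_pmf (Pair l) (\<mu> l))"
  \<comment> \<open>Labels outside of the range have probability 0; they are only sent somewhere into the space.\<close>
  define F where "F = (\<lambda>(l, a). if l \<in> {1..L} then (z l a, l) else (z 1 a, 1))"
  define Q where "Q = distr (measure_pmf R) ?S F"
  have F: "F \<in> measurable (measure_pmf R) ?S"
    using z L by (auto simp: F_def space_pair_measure split: prod.split)
  have space_Q: "space Q = space (traj_space T) \<times> {1..L}"
    by (simp add: Q_def space_pair_measure)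
  have Q_rect: "emeasure Q (A \<times> {l}) = ennreal (prb l) * emeasure (measure_pmf (\<mu> l)) {a. z l a \<in> A}"
    if l: "l \<in> {1..L}" and A: "A \<in> sets (traj_space T)" for A l
  proof -
    have "emeasure Q (A \<times> {l}) = emeasure (measure_pmf R) (F -` (A \<times> {l}))"
      unfolding Q_def using F A l by (subst emeasure_distr) auto
    also have "\<dots> = (\<integral>\<^sup>+ l'. emeasure (measure_pmf (\<mu> l')) {a. F (l', a) \<in> A \<times> {l}} \<partial>measure_pmf pl)"
      unfolding R_def by (simp add: vimage_def)
    also have "\<dots> = (\<integral>\<^sup>+ l'. emeasure (measure_pmf (\<mu> l)) {a. z l a \<in> A} * indicator {l} l' \<partial>measure_pmf pl)"
    proof (intro nn_integral_cong_AE, unfold AE_measure_pmf_iff, intro ballI)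
      fix l' assume "l' \<in> set_pmf pl"
      then have "l' \<in> {1..L}" by (auto simp: set_pmf_iff pmf_pl split: if_splits)
      then show "emeasure (measure_pmf (\<mu> l')) {a. F (l', a) \<in> A \<times> {l}}
          = emeasure (measure_pmf (\<mu> l)) {a. z l a \<in> A} * indicator {l} l'"
        by (cases "l' = l") (auto simp: F_def)
    qed
    also have "\<dots> = ennreal (prb l) * emeasure (measure_pmf (\<mu> l)) {a. z l a \<in> A}"
      using l by (subst nn_integral_cmult) (simp_all add: emeasure_pmf_single pmf_pl mult.commute)
    finally show ?thesis .
  qed
  have B: "{\<omega> \<in> space Q. snd \<omega> = l} = space (traj_space T) \<times> {l}" if "l \<in> {1..L}" for l
    using that by (auto simp: space_Q)
  have emeasure_B: "emeasure Q (space (traj_space T) \<times> {l}) = ennreal (prb l)" if l: "l \<in> {1..L}" for l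
    using Q_rect[OF l, of "space (traj_space T)"] z[OF l] by simp
  show ?thesis
  proof (rule that)
    show "prob_space Q" unfolding Q_def by (intro measure_pmf.prob_space_distr F)
    show sets_Q: "sets Q = sets ?S" by (simp only: Q_def sets_distr)
    fix l assume l: "l \<in> {1..L}"
    show "\<P>(\<omega> in Q. snd \<omega> = l) = prb l"
      unfolding B[OF l] using emeasure_B[OF l] prb(1)[OF l] by (simp add: measure_def)
    assume pos: "prb l > 0"
    show "cond_law T Q l = distr (measure_pmf (\<mu> l)) (traj_space T) (z l)"
    proof (rule measure_eqI)
      fix A assume "A \<in> sets (cond_law T Q l)"
      then have A: "A \<in> sets (traj_space T)" by (simp add: cond_law_def)
      have "fst \<in> measurable Q (traj_space T)"
        using measurable_cong_sets[OF sets_Q refl] by auto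
      then have fst_meas:
        "fst \<in> measurable (uniform_measure Q (space (traj_space T) \<times> {l})) (traj_space T)"
        by (simp add: measurable_def)
      have B_sets: "space (traj_space T) \<times> {l} \<in> sets Q" using l by (simp add: sets_Q)
      have A_sets: "fst -` A \<inter> space Q \<in> sets Q"
        using measurable_sets[OF fst_meas A] by simp
      have "emeasure (cond_law T Q l) A
          = emeasure (uniform_measure Q (space (traj_space T) \<times> {l})) (fst -` A \<inter> space Q)"
        unfolding cond_law_def B[OF l] by (subst emeasure_distr[OF fst_meas A]) simp
      also have "\<dots> = emeasure Q ((space (traj_space T) \<times> {l}) \<inter> (fst -` A \<inter> space Q))
          / emeasure Q (space (traj_space T) \<times> {l})"
        using B_sets A_sets by simp
      also have "(space (traj_space T) \<times> {l}) \<inter> (fst -` A \<inter> space Q) = A \<times> {l}"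
        using sets.sets_into_space[OF A] l by (auto simp: space_Q)
      also have "emeasure Q (A \<times> {l}) / emeasure Q (space (traj_space T) \<times> {l})
          = emeasure (measure_pmf (\<mu> l)) {a. z l a \<in> A}"
        unfolding Q_rect[OF l A] emeasure_B[OF l] using pos
        by (simp add: mult.commute[of "ennreal (prb l)"] ennreal_mult_divide_eq)
      also have "\<dots> = emeasure (distr (measure_pmf (\<mu> l)) (traj_space T) (z l)) A"
        using A z[OF l] by (subst emeasure_distr) (auto simp: vimage_def)
      finally show "emeasure (cond_law T Q l) A
          = emeasure (distr (measure_pmf (\<mu> l)) (traj_space T) (z l)) A" .
    qed (simp add: cond_law_def)
  qed
qed

lemma restrict_space_distr_pmf:
  assumes X: "X \<in> sets M" and z: "\<And>a. z a \<in> X"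
  shows "restrict_space (distr (measure_pmf \<mu>) M z) X = distr (measure_pmf \<mu>) (restrict_space M X) z"
proof -
  have zM: "z a \<in> space M" for a using z sets.sets_into_space[OF X] by blast
  show ?thesis
  proof (rule measure_eqI)
    show "sets (restrict_space (distr (measure_pmf \<mu>) M z) X)
        = sets (distr (measure_pmf \<mu>) (restrict_space M X) z)"
      by (simp add: sets_restrict_space)
    fix E assume "E \<in> sets (restrict_space (distr (measure_pmf \<mu>) M z) X)"
    then have E: "E \<in> sets (restrict_space M X)" by (simp add: sets_restrict_space)
    then have E': "E \<in> sets M" "E \<subseteq> X" using X by (auto simp: sets_restrict_space_iff)
    have "emeasure (restrict_space (distr (measure_pmf \<mu>) M z) X) E
        = emeasure (distr (measure_pmf \<mu>) M z) E"
      using X E' by (intro emeasure_restrict_space) auto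
    also have "\<dots> = emeasure (measure_pmf \<mu>) (z -` E)"
      using E' zM by (subst emeasure_distr) auto
    also have "\<dots> = emeasure (distr (measure_pmf \<mu>) (restrict_space M X) z) E"
      using E z zM by (subst emeasure_distr) (auto simp: space_restrict_space)
    finally show "emeasure (restrict_space (distr (measure_pmf \<mu>) M z) X) E
        = emeasure (distr (measure_pmf \<mu>) (restrict_space M X) z) E" .
  qed
qed

section \<open>The reformulation\<close>

text \<open>
  For fixed policy coefficients: the duality of each Wasserstein ball, weighted with the scenario
  probabilities. The optimal values are compared up to every \<open>e > 0\<close>, as the supremum over the
  ambiguity set need not be attained.
\<close>

lemma worst_case_expectation_eq:
  fixes d :: "nat \<Rightarrow> nat \<Rightarrow> nat \<Rightarrow> 'n::finite \<Rightarrow> nat \<Rightarrow> real"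
    and xhat :: "nat \<Rightarrow> nat \<Rightarrow> 'n trajectory"
  assumes T: "T \<ge> 1" and K: "K \<ge> 1"
    and prb: "\<And>l. l \<in> {1..L} \<Longrightarrow> prb l \<ge> 0" "(\<Sum>l=1..L. prb l) = 1"
    and radius: "\<And>l. l \<in> {1..L} \<Longrightarrow> \<theta> l > 0"
    and N: "\<And>l. l \<in> {1..L} \<Longrightarrow> N l \<ge> 1"
    and xhat: "\<And>l s. l \<in> {1..L} \<Longrightarrow> s \<in> {1..N l} \<Longrightarrow> xhat l s \<in> support_box T (lo l) (hi l)"
    and p: "\<And>l t i. l \<in> {1..L} \<Longrightarrow> t \<in> {1..T} \<Longrightarrow> p l t i \<ge> 1"
    and mono: "\<And>l t i. l \<in> {1..L} \<Longrightarrow> t \<in> {1..T} \<Longrightarrow> mono_on {..p l t i} (w l t i)"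
    and lo: "\<And>l t i. l \<in> {1..L} \<Longrightarrow> t \<in> {1..T} \<Longrightarrow> w l t i 0 = lo l t i"
    and hi: "\<And>l t i. l \<in> {1..L} \<Longrightarrow> t \<in> {1..T} \<Longrightarrow> w l t i (p l t i) = hi l t i"
  shows "(SUP Q\<in>ambiguity_set T L prb (\<lambda>l. support_box T (lo l) (hi l)) N xhat \<theta>.
            ereal (expected_cost T L K p w d r Q))
       = (INF v\<in>{v :: 'n aux_vars. aux_feasible T L K N xhat p w d r v}.
            ereal (aux_objective L prb \<theta> N v))"
proof -
  define X where "X l = support_box T (lo l) (hi l)" for l
  define S where "S l = restrict_space (traj_space T) (X l)" for l
  define f where "f l = reward T K (p l) (w l) (d l) (r l)" for l
  \<comment> \<open>A sequence of samples in the support for every index; the empirical law only sees the first \<open>N l\<close>.\<close>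
  define xs where "xs l s = (if s \<in> {1..N l} then xhat l s else xhat l 1)" for l s
  have X: "X l \<in> sets (traj_space T)" for l unfolding X_def by (rule sets_support_box)
  have X_sub: "X l \<subseteq> space (traj_space T)" for l using sets.sets_into_space[OF X] .
  have space_S: "space (S l) = X l" for l
    using X_sub by (auto simp: S_def space_restrict_space)
  have cost: "(\<lambda>z. norm1_dist T (fst z) (snd z)) \<in> borel_measurable (S l \<Otimes>\<^sub>M S l)" for l
    unfolding S_def by (rule measurable_norm1_dist)
  have f_meas: "f l \<in> borel_measurable (traj_space T)" for l
    unfolding f_def by (rule measurable_reward)
  have f_meas_S: "f l \<in> borel_measurable (S l)" for l
    unfolding S_def by (rule measurable_restrict_space1[OF f_meas])
  have "\<forall>l. \<exists>b. \<forall>\<xi>\<in>X l. \<bar>f l \<xi>\<bar> \<le> b"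
    unfolding X_def f_def using bounded_reward[OF K] by metis
  then obtain b where b: "\<And>l \<xi>. \<xi> \<in> X l \<Longrightarrow> \<bar>f l \<xi>\<bar> \<le> b l"
    unfolding choice_iff by blast
  have xs: "xs l s \<in> space (S l)" if "l \<in> {1..L}" for l s
    using xhat[OF that, of s] xhat[OF that, of 1] N[OF that] by (auto simp: xs_def space_S X_def)
  have xs_sets: "{xs l s} \<in> sets (S l)" if "l \<in> {1..L}" for l s
    using xs[OF that, of s] X_sub[of l] X[of l]
    by (auto simp: S_def sets_restrict_space_iff space_S[unfolded S_def]
      intro!: singleton_sets_traj_space)
  have emp: "empirical (S l) (N l) (xhat l) = empirical (S l) (N l) (xs l)" for l
  proof -
    have "(\<Sum>s=1..N l. emeasure (return (S l) (xhat l s)) E)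
        = (\<Sum>s=1..N l. emeasure (return (S l) (xs l s)) E)" for E
      by (intro sum.cong) (auto simp: xs_def)
    then show ?thesis by (simp only: empirical_def)
  qed
  have expected: "expected_cost T L K p w d r Q
      = (\<Sum>l=1..L. prb l * (\<integral>\<xi>. f l \<xi> \<partial>restrict_space (cond_law T Q l) (X l)))"
    if Q: "Q \<in> ambiguity_set T L prb X N xhat \<theta>" for Q
  proof -
    have Q': "prob_space Q" "sets Q = sets (traj_space T \<Otimes>\<^sub>M count_space {1..L})"
      "\<And>l. l \<in> {1..L} \<Longrightarrow> \<P>(\<omega> in Q. snd \<omega> = l) = prb l"
      "\<And>l. l \<in> {1..L} \<Longrightarrow> prb l > 0 \<Longrightarrow> \<P>(\<omega> in Q. fst \<omega> \<in> X l \<bar> snd \<omega> = l) = 1"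
      using Q by (auto simp: ambiguity_set_def)
    note scenario = integral_scenario[OF Q'(1,2) Q'(3) Q'(4) X f_meas b]
    have "expected_cost T L K p w d r Q
        = (\<integral>\<omega>. (\<Sum>l=1..L. indicator {l} (snd \<omega>) * f l (fst \<omega>)) \<partial>Q)"
      by (simp add: expected_cost_def f_def reward_def)
    also have "\<dots> = (\<Sum>l=1..L. \<integral>\<omega>. indicator {l} (snd \<omega>) * f l (fst \<omega>) \<partial>Q)"
      by (intro Bochner_Integration.integral_sum scenario(1))
    also have "\<dots> = (\<Sum>l=1..L. prb l * (\<integral>\<xi>. f l \<xi> \<partial>restrict_space (cond_law T Q l) (X l)))"
      by (intro sum.cong refl scenario(2))
    finally show ?thesis .
  qed
  have constraints_iff:
    "(\<exists>h z. sample_constraints T K (p l) (w l) (d l) (r l) y \<rho> e h z) \<longleftrightarrow>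
      (\<forall>\<xi>\<in>X l. f l \<xi> \<le> e + \<rho> * norm1_dist T \<xi> y)" if l: "l \<in> {1..L}" and \<rho>: "\<rho> \<ge> 0" for l y \<rho> e
    unfolding X_def f_def
    by (rule sample_constraints_iff[OF mono[OF l] p[OF l] lo[OF l] hi[OF l] \<rho> K])
  \<comment> \<open>A scenario of probability 0 has no conditional law, but it also contributes nothing to either side.\<close>
  have weak: "expected_cost T L K p w d r Q \<le> aux_objective L prb \<theta> N v"
    if Q: "Q \<in> ambiguity_set T L prb X N xhat \<theta>"
      and v: "aux_feasible T L K N xhat p w d r v" for Q and v :: "'n aux_vars"
    unfolding expected[OF Q] aux_objective_def
  proof (intro sum_mono)
    fix l assume l: "l \<in> {1..L}"
    show "prb l * (\<integral>\<xi>. f l \<xi> \<partial>restrict_space (cond_law T Q l) (X l))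
        \<le> prb l * (lam v l * \<theta> l + 1 / real (N l) * (\<Sum>s=1..N l. eta v l s))"
    proof (cases "prb l > 0")
      case True
      have constr: "sample_constraints T K (p l) (w l) (d l) (r l) (xhat l s) (lam v l) (eta v l s)
          (eta_comp v l s) (zeta v l s)" if "s \<in> {1..N l}" for s
        using v l that unfolding aux_feasible_iff by blast
      have lam: "lam v l \<ge> 0"
        using sample_constraints_imp_nonneg[OF constr[of 1] K T p] l T N[OF l] by auto
      have "(\<integral>\<xi>. f l \<xi> \<partial>restrict_space (cond_law T Q l) (X l))
          \<le> lam v l * \<theta> l + 1 / real (N l) * (\<Sum>s=1..N l. eta v l s)"
      proof (rule integral_le_on_wasserstein_ball[OF f_meas_S _ cost N xs xs_sets lam])
        show "\<bar>f l \<xi>\<bar> \<le> b l" if "\<xi> \<in> space (S l)" for \<xi> using that b by (simp add: space_S)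
        show "wasserstein T (S l) (restrict_space (cond_law T Q l) (X l))
            (empirical (S l) (N l) (xs l)) \<le> ennreal (\<theta> l)"
          unfolding emp[symmetric] unfolding S_def using Q l True by (simp add: ambiguity_set_def)
        show "f l \<xi> \<le> eta v l s + lam v l * norm1_dist T \<xi> (xs l s)"
          if "\<xi> \<in> space (S l)" "s \<in> {1..N l}" for \<xi> s
          using constraints_iff[OF l lam, of "xhat l s" "eta v l s"] constr[OF that(2)] that
          by (auto simp: space_S xs_def)
      qed (use l radius[OF l] in auto)
      then show ?thesis using True by (intro mult_left_mono) auto
    next
      case False
      then show ?thesis using prb(1)[OF l] by simp
    qed
  qed
  have strong: "\<exists>v Q. aux_feasible T L K N xhat p w d r v \<and> Q \<in> ambiguity_set T L prb X N xhat \<theta> \<and>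
      aux_objective L prb \<theta> N v \<le> expected_cost T L K p w d r Q + e" if e: "e > 0" for e
  proof -
    define good where "good l \<rho> \<eta> \<mu> z \<longleftrightarrow> \<rho> \<ge> 0 \<and>
      (\<forall>s. \<forall>\<xi>\<in>X l. f l \<xi> \<le> \<eta> s + \<rho> * norm1_dist T \<xi> (xs l s)) \<and>
      (\<forall>a. z a \<in> X l) \<and>
      wasserstein T (S l) (distr (measure_pmf \<mu>) (S l) z) (empirical (S l) (N l) (xs l)) \<le> ennreal (\<theta> l) \<and>
      \<rho> * \<theta> l + 1 / real (N l) * (\<Sum>s=1..N l. \<eta> s) \<le> (\<integral>\<xi>. f l \<xi> \<partial>distr (measure_pmf \<mu>) (S l) z) + e"
      for l \<rho> \<eta> and \<mu> :: "(nat \<times> bool) pmf" and z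
    have "\<exists>\<rho> \<eta> \<mu> z. good l \<rho> \<eta> \<mu> z" if l: "l \<in> {1..L}" for l
    proof (rule nearly_optimal_mixture[where xs = "xs l",
          OF f_meas_S _ cost N[OF l] xs[OF l] radius[OF l] e])
      show "\<bar>f l \<xi>\<bar> \<le> b l" if "\<xi> \<in> space (S l)" for \<xi> using that b by (simp add: space_S)
    qed (unfold space_S good_def, blast)
    then have "\<forall>l. \<exists>\<rho> \<eta> \<mu> z. l \<in> {1..L} \<longrightarrow> good l \<rho> \<eta> \<mu> z" by blast
    then obtain \<rho> \<eta> \<mu> z where good: "\<And>l. l \<in> {1..L} \<Longrightarrow> good l (\<rho> l) (\<eta> l) (\<mu> l) (z l)"
      unfolding choice_iff by blast
    have z: "z l a \<in> X l" if "l \<in> {1..L}" for l a using good[OF that] unfolding good_def by blast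
    have "\<forall>l s. \<exists>h \<zeta>. l \<in> {1..L} \<and> s \<in> {1..N l} \<longrightarrow>
        sample_constraints T K (p l) (w l) (d l) (r l) (xhat l s) (\<rho> l) (\<eta> l s) h \<zeta>"
    proof (intro allI)
      fix l s
      show "\<exists>h \<zeta>. l \<in> {1..L} \<and> s \<in> {1..N l} \<longrightarrow>
          sample_constraints T K (p l) (w l) (d l) (r l) (xhat l s) (\<rho> l) (\<eta> l s) h \<zeta>"
      proof (cases "l \<in> {1..L} \<and> s \<in> {1..N l}")
        case True
        then have l: "l \<in> {1..L}" by simp
        have "\<rho> l \<ge> 0" "\<forall>\<xi>\<in>X l. f l \<xi> \<le> \<eta> l s + \<rho> l * norm1_dist T \<xi> (xs l s)"
          using good[OF l] by (auto simp: good_def)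
        then show ?thesis
          using constraints_iff[OF l, of "\<rho> l" "xhat l s" "\<eta> l s"] True
          by (simp add: xs_def)
      qed blast
    qed
    then obtain h \<zeta> where h: "\<And>l s. l \<in> {1..L} \<Longrightarrow> s \<in> {1..N l} \<Longrightarrow>
        sample_constraints T K (p l) (w l) (d l) (r l) (xhat l s) (\<rho> l) (\<eta> l s) (h l s) (\<zeta> l s)"
      unfolding choice_iff by blast
    define v where "v = \<lparr>lam = \<rho>, eta = \<eta>, eta_comp = h, zeta = \<zeta>\<rparr>"
    have feasible: "aux_feasible T L K N xhat p w d r v"
      using h by (simp add: aux_feasible_iff v_def)
    obtain Q where Q: "prob_space Q" "sets Q = sets (traj_space T \<Otimes>\<^sub>M count_space {1..L})"
      "\<And>l. l \<in> {1..L} \<Longrightarrow> \<P>(\<omega> in Q. snd \<omega> = l) = prb l"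
      "\<And>l. l \<in> {1..L} \<Longrightarrow> prb l > 0 \<Longrightarrow>
         cond_law T Q l = distr (measure_pmf (\<mu> l)) (traj_space T) (z l)"
      using exists_joint_law[OF prb, where \<mu> = \<mu> and z = z and T = T] z X_sub by blast
    have law: "restrict_space (cond_law T Q l) (X l) = distr (measure_pmf (\<mu> l)) (S l) (z l)"
      if l: "l \<in> {1..L}" "prb l > 0" for l
      unfolding Q(4)[OF l] S_def by (rule restrict_space_distr_pmf[OF X z[OF l(1)]])
    have Q_amb: "Q \<in> ambiguity_set T L prb X N xhat \<theta>"
    proof -
      have "\<P>(\<omega> in Q. fst \<omega> \<in> X l \<bar> snd \<omega> = l) = 1" if l: "l \<in> {1..L}" and pos: "prb l > 0" for l
      proof -
        interpret Q: prob_space Q by (rule Q(1))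
        define B where "B = {\<omega> \<in> space Q. snd \<omega> = l}"
        have "fst \<in> measurable Q (traj_space T)"
          using measurable_cong_sets[OF Q(2) refl] by auto
        then have fst_meas: "fst \<in> measurable (uniform_measure Q B) (traj_space T)"
          by (simp add: measurable_def)
        have prob_B: "Q.prob B = prb l" using Q(3)[OF l] by (simp add: B_def)
        then have B: "B \<in> sets Q" using pos measure_notin_sets[of B Q] by force
        have XB: "fst -` X l \<inter> space Q \<in> sets Q" using measurable_sets[OF fst_meas X] by simp
        have "1 = emeasure (distr (measure_pmf (\<mu> l)) (traj_space T) (z l)) (X l)"
        proof -
          have "z l -` X l = UNIV" using z[OF l] by auto
          then show ?thesis using X z[OF l] X_sub[of l] by (subst emeasure_distr) auto
        qed
        also have "\<dots> = emeasure (uniform_measure Q B) (fst -` X l \<inter> space Q)"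
          unfolding Q(4)[OF l pos, symmetric] cond_law_def B_def[symmetric]
          by (subst emeasure_distr[OF fst_meas X]) simp
        also have "\<dots> = ennreal (Q.prob (B \<inter> (fst -` X l \<inter> space Q)) / prb l)"
          using B XB pos by (simp add: Q.emeasure_eq_measure prob_B divide_ennreal)
        finally have "Q.prob (B \<inter> (fst -` X l \<inter> space Q)) / prb l = 1" by simp
        moreover have "B \<inter> (fst -` X l \<inter> space Q) = {\<omega> \<in> space Q. fst \<omega> \<in> X l \<and> snd \<omega> = l}"
          by (auto simp: B_def)
        ultimately show ?thesis using Q(3)[OF l] by (simp add: cond_prob_def)
      qed
      moreover have "wasserstein T (restrict_space (traj_space T) (X l))
          (restrict_space (cond_law T Q l) (X l))
          (empirical (restrict_space (traj_space T) (X l)) (N l) (xhat l)) \<le> ennreal (\<theta> l)"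
        if l: "l \<in> {1..L}" "prb l > 0" for l
        using good[OF l(1)] unfolding law[OF l] S_def[symmetric] emp by (simp add: good_def)
      ultimately show ?thesis using Q by (simp add: ambiguity_set_def)
    qed
    have "aux_objective L prb \<theta> N v
        \<le> (\<Sum>l=1..L. prb l * ((\<integral>\<xi>. f l \<xi> \<partial>restrict_space (cond_law T Q l) (X l)) + e))"
      unfolding aux_objective_def
    proof (intro sum_mono)
      fix l assume l: "l \<in> {1..L}"
      show "prb l * (lam v l * \<theta> l + 1 / real (N l) * (\<Sum>s=1..N l. eta v l s))
          \<le> prb l * ((\<integral>\<xi>. f l \<xi> \<partial>restrict_space (cond_law T Q l) (X l)) + e)"
      proof (cases "prb l > 0")
        case True
        then show ?thesis
          using good[OF l] prb(1)[OF l]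
          by (intro mult_left_mono) (simp_all add: law[OF l] good_def v_def)
      next
        case False
        then show ?thesis using prb(1)[OF l] by simp
      qed
    qed
    also have "\<dots> = expected_cost T L K p w d r Q + e"
      using prb(2) by (simp add: expected[OF Q_amb] distrib_left sum.distrib sum_distrib_right[symmetric])
    finally show ?thesis using feasible Q_amb by blast
  qed
  have X_eq: "(\<lambda>l. support_box T (lo l) (hi l)) = X" by (simp add: X_def fun_eq_iff)
  show ?thesis
    unfolding X_eq
  proof (rule antisym)
    show "(SUP Q\<in>ambiguity_set T L prb X N xhat \<theta>. ereal (expected_cost T L K p w d r Q))
       \<le> (INF v\<in>{v :: 'n aux_vars. aux_feasible T L K N xhat p w d r v}.
            ereal (aux_objective L prb \<theta> N v))"
      using weak by (intro SUP_least INF_greatest) auto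
    show "(INF v\<in>{v :: 'n aux_vars. aux_feasible T L K N xhat p w d r v}.
            ereal (aux_objective L prb \<theta> N v))
       \<le> (SUP Q\<in>ambiguity_set T L prb X N xhat \<theta>. ereal (expected_cost T L K p w d r Q))"
    proof (rule ereal_le_epsilon2)
      fix e :: real assume "e > 0"
      then obtain v Q where vQ: "aux_feasible T L K N xhat p w d r v"
        "Q \<in> ambiguity_set T L prb X N xhat \<theta>"
        "aux_objective L prb \<theta> N v \<le> expected_cost T L K p w d r Q + e"
        using strong by blast
      have "(INF v\<in>{v :: 'n aux_vars. aux_feasible T L K N xhat p w d r v}.
            ereal (aux_objective L prb \<theta> N v)) \<le> ereal (aux_objective L prb \<theta> N v)"
        using vQ(1) by (intro INF_lower) simp
      also have "\<dots> \<le> ereal (expected_cost T L K p w d r Q) + ereal e" using vQ(3) by simp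
      also have "\<dots> \<le> (SUP Q\<in>ambiguity_set T L prb X N xhat \<theta>.
          ereal (expected_cost T L K p w d r Q)) + ereal e"
        using vQ(2) by (intro add_right_mono SUP_upper)
      finally show "(INF v\<in>{v :: 'n aux_vars. aux_feasible T L K N xhat p w d r v}.
            ereal (aux_objective L prb \<theta> N v))
          \<le> (SUP Q\<in>ambiguity_set T L prb X N xhat \<theta>.
            ereal (expected_cost T L K p w d r Q)) + ereal e" .
    qed
  qed
qed

theorem theorem5:
  fixes T L K nI :: nat
    and prb \<theta> \<alpha> :: "nat \<Rightarrow> real"
    and N :: "nat \<Rightarrow> nat"
    and lo hi :: "nat \<Rightarrow> nat \<Rightarrow> 'n::finite \<Rightarrow> real"
    and xhat :: "nat \<Rightarrow> nat \<Rightarrow> 'n trajectory"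
    and p :: "nat \<Rightarrow> nat \<Rightarrow> 'n \<Rightarrow> nat"
    and w :: "nat \<Rightarrow> nat \<Rightarrow> 'n \<Rightarrow> nat \<Rightarrow> real"
    and x1 :: "real ^ 'x::finite"
    and A :: "nat \<Rightarrow> real ^ 'x ^ 'x"
    and B :: "nat \<Rightarrow> real ^ 'u::finite ^ 'x"
    and C :: "nat \<Rightarrow> real ^ 'g::finite ^ 'x"
    and D :: "nat \<Rightarrow> real ^ 'n ^ 'x"
    and a :: "nat \<Rightarrow> real ^ 'x" and b :: "nat \<Rightarrow> real ^ 'u" and c :: "nat \<Rightarrow> real ^ 'g"
    and d :: "nat \<Rightarrow> ('n, 'u, 'g) coeffs \<Rightarrow> nat \<Rightarrow> nat \<Rightarrow> 'n \<Rightarrow> nat \<Rightarrow> real"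
    and r :: "nat \<Rightarrow> ('n, 'u, 'g) coeffs \<Rightarrow> nat \<Rightarrow> real"
  defines "Xi \<equiv> \<lambda>l. support_box T (lo l) (hi l)"
  assumes "T \<ge> 1" and "K \<ge> 1" and "nI \<ge> 1"
    and prb: "\<And>l. l \<in> {1..L} \<Longrightarrow> prb l \<ge> 0" "(\<Sum>l=1..L. prb l) = 1"
    and radius: "\<And>l. l \<in> {1..L} \<Longrightarrow> \<theta> l > 0"
    and data: "\<And>l. l \<in> {1..L} \<Longrightarrow> N l \<ge> 1"
      "\<And>l s. l \<in> {1..L} \<Longrightarrow> s \<in> {1..N l} \<Longrightarrow> xhat l s \<in> Xi l"
    and breakpoints:
      "\<And>l t i. l \<in> {1..L} \<Longrightarrow> t \<in> {1..T} \<Longrightarrow> p l t i \<ge> 1"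
      "\<And>l t i. l \<in> {1..L} \<Longrightarrow> t \<in> {1..T} \<Longrightarrow> w l t i 0 = lo l t i"
      "\<And>l t i j. l \<in> {1..L} \<Longrightarrow> t \<in> {1..T} \<Longrightarrow> j \<in> {1..p l t i} \<Longrightarrow> w l t i (j - 1) \<le> w l t i j"
      "\<And>l t i. l \<in> {1..L} \<Longrightarrow> t \<in> {1..T} \<Longrightarrow> w l t i (p l t i) = hi l t i"
    and discount: "\<And>t. t \<in> {1..T} \<Longrightarrow> 0 \<le> \<alpha> t \<and> \<alpha> t \<le> 1"
    and affine_cost:
      "\<And>l k t i m. l \<in> {1..L} \<Longrightarrow> k \<in> {1..K} \<Longrightarrow> t \<in> {1..T} \<Longrightarrow> m \<in> {1..2 * p l t i - 1} \<Longrightarrow>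
         affine_in_coeffs T (p l) (\<lambda>\<pi>. d l \<pi> k t i m)"
      "\<And>l k. l \<in> {1..L} \<Longrightarrow> k \<in> {1..K} \<Longrightarrow> affine_in_coeffs T (p l) (\<lambda>\<pi>. r l \<pi> k)"
    and cost_representation:
      "\<And>l \<pi> \<xi> x. l \<in> {1..L} \<Longrightarrow> \<xi> \<in> Xi l \<Longrightarrow>
         system_trajectory T x1 A B C D x
           (policy_u (p l) (w l) \<pi> \<xi>) (policy_gamma (p l) (w l) \<pi> \<xi>) \<xi> \<Longrightarrow>
         total_cost T \<alpha> nI a b c x
           (policy_u (p l) (w l) \<pi> \<xi>) (policy_gamma (p l) (w l) \<pi> \<xi>)
         = (MAX k\<in>{1..K}. full_dot T (p l) (w l) (d l \<pi> k) \<xi> + r l \<pi> k)"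
  shows "(\<forall>\<pi> :: nat \<Rightarrow> ('n, 'u, 'g) coeffs.
           (SUP Q\<in>ambiguity_set T L prb Xi N xhat \<theta>.
              ereal (expected_cost T L K p w (\<lambda>l. d l (\<pi> l)) (\<lambda>l. r l (\<pi> l)) Q))
           = (INF v\<in>{v :: 'n aux_vars.
                       aux_feasible T L K N xhat p w (\<lambda>l. d l (\<pi> l)) (\<lambda>l. r l (\<pi> l)) v}.
                ereal (aux_objective L prb \<theta> N v)))
       \<and> (INF \<pi>\<in>(UNIV :: (nat \<Rightarrow> ('n, 'u, 'g) coeffs) set).
            SUP Q\<in>ambiguity_set T L prb Xi N xhat \<theta>.
              ereal (expected_cost T L K p w (\<lambda>l. d l (\<pi> l)) (\<lambda>l. r l (\<pi> l)) Q))
         = (INF (\<pi>, v)\<in>{(\<pi> :: nat \<Rightarrow> ('n, 'u, 'g) coeffs, v :: 'n aux_vars).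
                    aux_feasible T L K N xhat p w (\<lambda>l. d l (\<pi> l)) (\<lambda>l. r l (\<pi> l)) v}.
              ereal (aux_objective L prb \<theta> N v))"
proof -
  have mono: "mono_on {..p l t i} (w l t i)" if "l \<in> {1..L}" "t \<in> {1..T}" for l t i
    using breakpoints(3)[OF that] by (rule mono_on_steps)
  have fixed: "(SUP Q\<in>ambiguity_set T L prb Xi N xhat \<theta>.
        ereal (expected_cost T L K p w (\<lambda>l. d l (\<pi> l)) (\<lambda>l. r l (\<pi> l)) Q))
      = (INF v\<in>{v :: 'n aux_vars.
            aux_feasible T L K N xhat p w (\<lambda>l. d l (\<pi> l)) (\<lambda>l. r l (\<pi> l)) v}.
          ereal (aux_objective L prb \<theta> N v))" for \<pi> :: "nat \<Rightarrow> ('n, 'u, 'g) coeffs"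
    unfolding Xi_def
    by (rule worst_case_expectation_eq[OF \<open>T \<ge> 1\<close> \<open>K \<ge> 1\<close> prb radius data[unfolded Xi_def]
          breakpoints(1) mono breakpoints(2) breakpoints(4)])
  moreover have "(INF \<pi>\<in>(UNIV :: (nat \<Rightarrow> ('n, 'u, 'g) coeffs) set).
        INF v\<in>{v :: 'n aux_vars.
            aux_feasible T L K N xhat p w (\<lambda>l. d l (\<pi> l)) (\<lambda>l. r l (\<pi> l)) v}.
          ereal (aux_objective L prb \<theta> N v))
      = (INF (\<pi>, v)\<in>{(\<pi> :: nat \<Rightarrow> ('n, 'u, 'g) coeffs, v :: 'n aux_vars).
            aux_feasible T L K N xhat p w (\<lambda>l. d l (\<pi> l)) (\<lambda>l. r l (\<pi> l)) v}.
          ereal (aux_objective L prb \<theta> N v))"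
    by (intro antisym INF_greatest) (auto intro: INF_lower INF_lower2)
  ultimately show ?thesis by simp
qed

end
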